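(* Let $L$ be a skew basic $(p,q)$-leaper with $p<q$. Let \[\frac qp=[c_1\pm,c_2\pm,\ldots,c_k]\] be the representation of $\frac qp$ as an even continued fraction, let \[\frac{q_i}{p_i}=[c_{i+1}\pm,c_{i+2}\pm,\ldots,c_k]\] for $i=1,2,\ldots,k-1$ (with the same signs), where $\frac{q_i}{p_i}$ is irreducible, and let $p_k=0$ and $q_k=1$. Then the leaper graph $G$ of $L$ over a $(p+q)\times(p+q)$ chessboard consists of $(q-p)^2$ isolated vertices and a number of disjoint cycles of $k$ distinct types. For all $i=1,\ldots,k$, $G$ contains $(q_i-p_i)^2$ cycles of type $i$, all of which are translation copies of each other and each of which is also toured by a $(p_i,q_i)$-leaper.
   Context: A square is a unit square of the infinite chessboard; a board is a set of squares. For nonnegative integers $p,q$, not both zero, a $(p,q)$-leaper is a piece that moves from a square $a$ to any of $a+(\pm p,\pm q)$, $a+(\pm q,\pm p)$; a $(p,q)$-leaper and a $(q,p)$-leaper are the same leaper. The leaper graph of $L$ over a board $B$ has the squares of $B$ as vertices, two squares being adjacent when a move of $L$ joins them. A cycle is "toured" by a leaper $M$ if the leaper graph of $M$ over the set of squares visited by the cycle contains a Hamiltonian cycle. A $(p,q)$-leaper is basic if $p+q$ is odd and $\gcd(p,q)=1$, and skew if $p\ne0$, $q\neq0$, $p\ne q$. An even continued fraction is an expression \[[c_1\pm,c_2\pm,\ldots,c_k]=c_1\pm\cfrac1{c_2\pm\cfrac1{\ddots\pm\frac1{c_k}}},\] where each of the $k-1$ signs is chosen independently, every $c_i$ is an even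 integer, $c_1$ is nonnegative, and $c_2,\ldots,c_k$ are positive. A nonnegative rational $\frac qp$ in lowest terms has a finite even continued fraction representation if and only if $p+q$ is odd, and that representation is unique. "Cycles of $k$ distinct types" means that the cycles of $G$ are divided into $k$ pairwise disjoint classes, called type $1$, ..., type $k$. *)

theory Defs
  imports Complex_Main "HOL-Library.Product_Plus"
begin

type_synonym square = "int \<times> int"

text \<open>A simple undirected graph is a pair of a vertex set and a set of two-element edges.\<close>

type_synonym 'a ugraph = "'a set \<times> 'a set set"

abbreviation verts :: "'a ugraph \<Rightarrow> 'a set" where "verts \<equiv> fst"
abbreviation edges :: "'a ugraph \<Rightarrow> 'a set set" where "edges \<equiv> snd"

definition subgraph :: "'a ugraph \<Rightarrow> 'a ugraph \<Rightarrow> bool" where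
  "subgraph H G \<longleftrightarrow> verts H \<subseteq> verts G \<and> edges H \<subseteq> edges G"

definition is_cycle :: "'a ugraph \<Rightarrow> bool" where
  "is_cycle C \<longleftrightarrow> (\<exists>vs. distinct vs \<and> length vs \<ge> 3 \<and> verts C = set vs \<and>
     edges C = {{vs ! i, vs ! (Suc i mod length vs)} | i. i < length vs})"

definition has_hamiltonian_cycle :: "'a ugraph \<Rightarrow> bool" where
  "has_hamiltonian_cycle G \<longleftrightarrow> (\<exists>C. is_cycle C \<and> subgraph C G \<and> verts C = verts G)"

text \<open>\<open>G\<close> is the vertex-disjoint union of the edgeless graph on \<open>I\<close> and of the cycles in \<open>\<C>\<close>;
  since every edge of \<open>G\<close> belongs to some cycle in \<open>\<C>\<close>, the vertices in \<open>I\<close> are exactly the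
  isolated vertices of \<open>G\<close>, and the members of \<open>\<C>\<close> are all the cycles of \<open>G\<close>.\<close>

definition consists_of :: "'a ugraph \<Rightarrow> 'a set \<Rightarrow> 'a ugraph set \<Rightarrow> bool" where
  "consists_of G I \<C> \<longleftrightarrow>
     (\<forall>C\<in>\<C>. is_cycle C) \<and>
     (\<forall>C\<in>\<C>. \<forall>D\<in>\<C>. C \<noteq> D \<longrightarrow> verts C \<inter> verts D = {}) \<and>
     (\<forall>C\<in>\<C>. I \<inter> verts C = {}) \<and>
     verts G = I \<union> (\<Union>C\<in>\<C>. verts C) \<and>
     edges G = (\<Union>C\<in>\<C>. edges C)"

definition leaper_move :: "nat \<Rightarrow> nat \<Rightarrow> square \<Rightarrow> square \<Rightarrow> bool" where
  "leaper_move p q a b \<longleftrightarrow>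
     (\<exists>s\<in>{1, -1}. \<exists>t\<in>{1, -1}. b = a + (s * int p, t * int q) \<or> b = a + (s * int q, t * int p))"

definition leaper_graph :: "nat \<Rightarrow> nat \<Rightarrow> square set \<Rightarrow> square ugraph" where
  "leaper_graph p q B = (B, {{a, b} | a b. a \<in> B \<and> b \<in> B \<and> leaper_move p q a b})"

definition chessboard :: "nat \<Rightarrow> square set" where
  "chessboard n = {0..<int n} \<times> {0..<int n}"

definition basic_leaper :: "nat \<Rightarrow> nat \<Rightarrow> bool" where
  "basic_leaper p q \<longleftrightarrow> odd (p + q) \<and> coprime p q"

definition skew_leaper :: "nat \<Rightarrow> nat \<Rightarrow> bool" where
  "skew_leaper p q \<longleftrightarrow> p \<noteq> 0 \<and> q \<noteq> 0 \<and> p \<noteq> q"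

definition toured_by :: "square ugraph \<Rightarrow> nat \<Rightarrow> nat \<Rightarrow> bool" where
  "toured_by C p q \<longleftrightarrow> has_hamiltonian_cycle (leaper_graph p q (verts C))"

definition translate :: "square \<Rightarrow> square ugraph \<Rightarrow> square ugraph" where
  "translate t C = ((+) t ` verts C, (\<lambda>e. (+) t ` e) ` edges C)"

text \<open>The continued fraction with terms \<open>cs\<close> = $c_1, \ldots, c_k$ and signs \<open>ss\<close>, where
  \<open>ss ! i\<close>, being \<open>1\<close> or \<open>-1\<close>, is the sign between \<open>cs ! i\<close> and \<open>cs ! Suc i\<close>. The remaining
  equation is a dummy for lists of mismatched lengths. For an even continued fraction,
  every proper tail has value at least 1, so that no division by zero occurs.\<close>

fun cf_value :: "int list \<Rightarrow> int list \<Rightarrow> rat" where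
  "cf_value [c] [] = of_int c"
| "cf_value (c # cs) (s # ss) = of_int c + of_int s / cf_value cs ss"
| "cf_value _ _ = 0"

definition even_cf :: "int list \<Rightarrow> int list \<Rightarrow> bool" where
  "even_cf cs ss \<longleftrightarrow> length cs = length ss + 1 \<and> set ss \<subseteq> {1, -1} \<and>
     (\<forall>c\<in>set cs. even c) \<and> hd cs \<ge> 0 \<and> (\<forall>c\<in>set (tl cs). c > 0)"

end

theory Submission
  imports Defs
begin

text \<open>The board of side \<open>p + q\<close> is centred at the origin. Write \<open>q = c p + e\<close> with \<open>c\<close> even, so that the
  next leaper of the continued fraction is the \<open>(\<bar>e\<bar>, p)\<close>-leaper \<open>L'\<close>. The central square of side
  \<open>q - p\<close> consists of isolated vertices and every other vertex has degree 2. The rest of the board is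
  covered by translates of the board of \<open>L'\<close>, centred at the points
  \<open>(l p, \<plusminus>(c p / 2 + [l + c / 2 odd] e))\<close> and their transposes. Relating squares of the two boards
  along these translates, adjacent squares always share a related square and vice versa, so the
  components of the large graph outside the centre correspond to those of the graph of \<open>L'\<close>, isolated
  vertices included. The isolated vertices of the board of the \<open>i\<close>-th leaper thus give rise to the
  cycles of type \<open>i + 1\<close>, and all constructions commute with the translations in question.

  The tour by the \<open>(p\<^sub>i, q\<^sub>i)\<close>-leaper is carried along. Along one side of the large board, arcs of the tour
  of the small cycle, alternately an upper and a lower one, are glued together where consecutive
  translates overlap. Four rotated copies of the resulting path close up.\<close>

section \<open>Cycles in two-regular graphs\<close>

text \<open>The obstacle is that neighbouring translates overlap, so a square of the large board may
  be related to several squares of the small one. They all lie in one component: neighbouring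
  translates on one side differ by \<open>(p, e)\<close> up to signs, a move of \<open>L'\<close>,
  and in the corner regions rows and columns share the translates centred at \<open>(w, w)\<close>
  up to signs, where \<open>w = c p / 2\<close>. Components are therefore handled as parts of sets
  closed under adjacency, which can be carried along a many-to-many relation. The stagger by
  \<open>0\<close> or \<open>e\<close> comes from the moves: two squares that differ by
  \<open>(p, c p + e)\<close> lie in opposite bands, in translates \<open>l\<close> and
  \<open>l + 1\<close>, and their offsets agree exactly when the two staggers add up to
  \<open>e\<close>. Commuting with translations is not automatic, since a shift could push a square
  across a border of the central square. The induction therefore carries the invariant that the
  shifts in question keep each coordinate in the same one of the three strips cut out by that
  square. The second leaper enters at the isolated vertices: consecutive copies of one along a side
  differ by a move of \<open>L'\<close> itself.\<close>

definition reach :: "('a \<Rightarrow> 'a \<Rightarrow> bool) \<Rightarrow> 'a set \<Rightarrow> 'a \<Rightarrow> 'a \<Rightarrow> bool" where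
  "reach E S a b \<longleftrightarrow> (a, b) \<in> {(a, b). a \<in> S \<and> b \<in> S \<and> E a b}\<^sup>*"

definition connected_on :: "('a \<Rightarrow> 'a \<Rightarrow> bool) \<Rightarrow> 'a set \<Rightarrow> bool" where
  "connected_on E S \<longleftrightarrow> (\<forall>a\<in>S. \<forall>b\<in>S. reach E S a b)"

lemma reach_refl [simp]: "reach E S a a"
  by (simp add: reach_def)

lemma reach_trans [trans]: "reach E S a b \<Longrightarrow> reach E S b c \<Longrightarrow> reach E S a c"
  unfolding reach_def by (rule rtrancl_trans)

lemma reach_step: "a \<in> S \<Longrightarrow> b \<in> S \<Longrightarrow> E a b \<Longrightarrow> reach E S a b"
  unfolding reach_def by (auto intro: r_into_rtrancl)

lemma reach_sym:
  assumes "reach E S a b" "\<And>a b. E a b \<Longrightarrow> E b a"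
  shows "reach E S b a"
proof -
  have "sym {(a, b). a \<in> S \<and> b \<in> S \<and> E a b}"
    using assms(2) by (auto simp: sym_def)
  from sym_rtrancl[OF this] show ?thesis
    using assms(1) by (auto simp: reach_def sym_def)
qed

lemma reach_closed:
  assumes "reach E S a b" "a \<in> V" "\<And>x y. x \<in> V \<Longrightarrow> x \<in> S \<Longrightarrow> y \<in> S \<Longrightarrow> E x y \<Longrightarrow> y \<in> V"
  shows "b \<in> V"
  using assms(1) unfolding reach_def
  by (induction rule: rtrancl_induct) (use assms(2,3) in auto)

definition two_regular_on :: "('a \<Rightarrow> 'a \<Rightarrow> bool) \<Rightarrow> 'a set \<Rightarrow> bool" where
  "two_regular_on E S \<longleftrightarrow> (\<forall>a\<in>S. card {b \<in> S. E a b} = 2)"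

definition graph_of :: "('a \<Rightarrow> 'a \<Rightarrow> bool) \<Rightarrow> 'a set \<Rightarrow> 'a ugraph" where
  "graph_of E S = (S, {{a, b} |a b. a \<in> S \<and> b \<in> S \<and> E a b})"

lemma two_regular_third:
  assumes "two_regular_on E S" "v \<in> S" "a \<in> S" "b \<in> S" "E v a" "E v b" "a \<noteq> b" "c \<in> S" "E v c"
  shows "c = a \<or> c = b"
proof (rule ccontr)
  assume neg: "\<not> ?thesis"
  have c2: "card {b \<in> S. E v b} = 2" using assms by (auto simp: two_regular_on_def)
  then have fin: "finite {b \<in> S. E v b}" by (metis card.infinite zero_neq_numeral)
  have "card {a, b, c} \<le> card {b \<in> S. E v b}"
    by (rule card_mono[OF fin]) (use assms in auto)
  moreover have "card {a, b, c} = 3" using neg assms by auto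
  ultimately show False using c2 by simp
qed

lemma two_regular_obtain:
  assumes "two_regular_on E S" "v \<in> S"
  obtains a b where "a \<in> S" "b \<in> S" "E v a" "E v b" "a \<noteq> b"
proof -
  have "card {b \<in> S. E v b} = 2" using assms by (auto simp: two_regular_on_def)
  then obtain a b where "{b \<in> S. E v b} = {a, b}" "a \<noteq> b" by (auto simp: card_2_iff)
  then show ?thesis by (intro that[of a b]) blast+
qed

text \<open>A longest path closes up: both neighbours of an end point lie on it, and its inner vertices
  have no neighbours to spare. By connectedness the resulting cycle is everything.\<close>

lemma connected_two_regular_is_cycle:
  assumes fin: "finite S" and ne: "S \<noteq> {}" and reg: "two_regular_on E S"
    and con: "connected_on E S"
    and sym: "\<And>a b. E a b \<Longrightarrow> E b a" and irr: "\<And>a. \<not> E a a"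
  shows "is_cycle (graph_of E S)"
proof -
  let ?path = "\<lambda>vs. distinct vs \<and> set vs \<subseteq> S \<and> vs \<noteq> [] \<and> successively E vs"
  obtain v0 where "v0 \<in> S" using ne by auto
  then have ex: "?path [v0]" by auto
  have bound: "\<forall>vs. ?path vs \<longrightarrow> length vs < Suc (card S)"
    using fin by (metis card_mono distinct_card le_imp_less_Suc)
  define vs where "vs = (ARG_MAX length vs. ?path vs)"
  have vs: "?path vs" and "\<And>ws. ?path ws \<Longrightarrow> length ws \<le> length vs"
    using arg_max_nat_lemma[of ?path, OF ex bound] unfolding vs_def by blast+
  note max = this(2)
  define n where "n = length vs"
  have n0: "n > 0" using vs by (simp add: n_def)
  have nth_S: "vs ! i \<in> S" if "i < n" for i using vs that n_def by (metis nth_mem subsetD)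
  have adj: "E (vs ! i) (vs ! Suc i)" if "Suc i < n" for i
    using vs that n_def by (simp add: successively_conv_nth)
  have inj: "vs ! i = vs ! j \<longleftrightarrow> i = j" if "i < n" "j < n" for i j
    using vs that n_def by (simp add: nth_eq_iff_index_eq)
  have front: "w \<in> set vs" if "w \<in> S" "E (hd vs) w" for w
  proof (rule ccontr)
    assume "w \<notin> set vs"
    then have "?path (w # vs)" using vs that sym by (cases vs) (auto simp: successively_Cons)
    from max[OF this] show False by simp
  qed
  have hd0: "hd vs = vs ! 0" using vs by (simp add: hd_conv_nth)
  obtain a b where ab: "a \<in> S" "b \<in> S" "E (vs ! 0) a" "E (vs ! 0) b" "a \<noteq> b"
    using two_regular_obtain[OF reg nth_S[OF n0]] by blast
  have inner: "j = Suc i \<or> i = Suc j" if "Suc i < n" "j < n" "E (vs ! i) (vs ! j)" "i > 0" for i j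
  proof -
    have "vs ! j = vs ! (i - 1) \<or> vs ! j = vs ! Suc i"
      by (rule two_regular_third[OF reg nth_S[of i]])
        (use that nth_S adj[of i] sym[OF adj[of "i - 1"]] inj in auto)
    then show ?thesis using inj that by auto
  qed
  obtain ia where ia: "ia < n" "a = vs ! ia" using front[of a] ab hd0 by (auto simp: in_set_conv_nth n_def)
  obtain ib where ib: "ib < n" "b = vs ! ib" using front[of b] ab hd0 by (auto simp: in_set_conv_nth n_def)
  have ends: "i = 1 \<or> Suc i = n" if "i < n" "E (vs ! 0) (vs ! i)" for i
  proof (rule ccontr)
    assume neg: "\<not> ?thesis"
    have "i > 0" using that irr by (cases i) auto
    then have "0 = Suc i \<or> i = Suc 0" using inner[of i 0] neg that sym by auto
    then show False using neg by simp
  qed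
  have "ia \<noteq> ib" using ab ia ib by auto
  moreover have "ia = 1 \<or> Suc ia = n" "ib = 1 \<or> Suc ib = n" "ia \<noteq> 0" "ib \<noteq> 0"
    using ends[of ia] ends[of ib] ab ia ib irr by (auto intro: gr0I)
  \<comment> \<open>The two neighbours of \<open>vs ! 0\<close> occupy distinct positions among
    \<open>1\<close> and \<open>n - 1\<close>, so these positions differ and one of the neighbours
    is the end of the path.\<close>
  ultimately have n3: "n \<ge> 3" and "n - 1 = ia \<or> n - 1 = ib" using ia ib by linarith+
  then have clos: "E (vs ! 0) (vs ! (n - 1))" using ab ia ib by auto
  have nbr: "j = Suc i mod n \<or> i = Suc j mod n" if "i < n" "j < n" "E (vs ! i) (vs ! j)" for i j
  proof -
    consider "i = 0" | "Suc i = n" "i > 0" | "i > 0" "Suc i < n"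
      using \<open>i < n\<close> by (metis Suc_lessI neq0_conv)
    then show ?thesis
    proof cases
      case 1 then show ?thesis using ends[of j] that n3 by auto
    next
      case 2
      have "vs ! j = vs ! (i - 1) \<or> vs ! j = vs ! 0"
        by (rule two_regular_third[OF reg nth_S[of i]])
          (use 2 that nth_S sym[OF adj[of "i - 1"]] sym[OF clos] inj n3 in auto)
      then show ?thesis using inj[of j] that 2 by auto
    next
      case 3 then show ?thesis using inner[of i j] that by auto
    qed
  qed
  have step: "E (vs ! i) (vs ! (Suc i mod n))" if "i < n" for i
    using adj[of i] sym[OF clos] that by (cases "Suc i = n") auto
  have closed: "y \<in> set vs" if "x \<in> set vs" "y \<in> S" "E x y" for x y
  proof -
    obtain i where i: "i < n" "x = vs ! i" using \<open>x \<in> set vs\<close> by (auto simp: in_set_conv_nth n_def)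
    define j where "j = (if i = 0 then n - 1 else i - 1)"
    have j: "j < n" "Suc j mod n = i" using i n0 by (auto simp: j_def)
    define k where "k = Suc i mod n"
    have k: "k < n" "k \<noteq> j" using i n3 j by (auto simp: k_def j_def mod_Suc)
    have "y = vs ! j \<or> y = vs ! k"
      by (rule two_regular_third[OF reg nth_S[of i]])
        (use i j k that nth_S sym[OF step[of j]] step[of i] inj in \<open>auto simp: k_def\<close>)
    then show ?thesis using j k by (auto simp: n_def)
  qed
  have "set vs = S"
  proof
    show "S \<subseteq> set vs"
    proof
      fix b assume "b \<in> S"
      then have "reach E S (vs ! 0) b" using con nth_S[OF n0] by (auto simp: connected_on_def)
      then show "b \<in> set vs"
        by (rule reach_closed) (use closed n0 in \<open>auto simp: n_def\<close>)
    qed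
  qed (use vs in auto)
  moreover have "{{a, b} |a b. a \<in> S \<and> b \<in> S \<and> E a b} = {{vs ! i, vs ! (Suc i mod n)} |i. i < n}"
    (is "?A = ?B")
  proof
    show "?A \<subseteq> ?B"
    proof clarify
      fix x y assume xy: "x \<in> S" "y \<in> S" "E x y"
      then obtain i j where ij: "i < n" "x = vs ! i" "j < n" "y = vs ! j"
        using \<open>set vs = S\<close> by (metis in_set_conv_nth n_def)
      then have "j = Suc i mod n \<or> i = Suc j mod n" using nbr xy by auto
      then show "\<exists>i. {x, y} = {vs ! i, vs ! (Suc i mod n)} \<and> i < n"
        using ij by (metis insert_commute)
    qed
    show "?B \<subseteq> ?A"
    proof clarify
      fix i assume "i < n"
      then show "\<exists>a b. {vs ! i, vs ! (Suc i mod n)} = {a, b} \<and> a \<in> S \<and> b \<in> S \<and> E a b"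
        using step[of i] nth_S[of i] nth_S[of "Suc i mod n"] n0 by (intro exI conjI) auto
    qed
  qed
  ultimately show ?thesis
    unfolding is_cycle_def graph_of_def
    by (intro exI[of _ vs]) (use vs n3 n_def in auto)
qed

lemma successively_cyclic_nth:
  assumes "successively E vs" "E (last vs) (hd vs)" "i < length vs"
  shows "E (vs ! i) (vs ! (Suc i mod length vs))"
proof (cases "Suc i = length vs")
  case True
  moreover have "vs \<noteq> []" using assms(3) by auto
  ultimately have "last vs = vs ! i" "hd vs = vs ! 0"
    by (auto simp: last_conv_nth hd_conv_nth simp flip: \<open>Suc i = length vs\<close>)
  then show ?thesis using assms True by simp
next
  case False
  then show ?thesis using assms by (simp add: successively_conv_nth)
qed

lemma closed_path_hamiltonian:
  assumes "distinct vs" "length vs \<ge> 3" "successively E vs" "E (last vs) (hd vs)"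
  shows "has_hamiltonian_cycle (graph_of E (set vs))"
proof -
  let ?C = "(set vs, {{vs ! i, vs ! (Suc i mod length vs)} | i. i < length vs})"
  have "is_cycle ?C" unfolding is_cycle_def using assms by auto
  moreover have "\<exists>a b. {vs ! i, vs ! (Suc i mod length vs)} = {a, b} \<and> a \<in> set vs \<and> b \<in> set vs \<and> E a b"
    if "i < length vs" for i
    using successively_cyclic_nth[OF assms(3,4) that] that
    by (intro exI conjI) (auto intro!: nth_mem mod_less_divisor)
  then have "subgraph ?C (graph_of E (set vs))"
    unfolding subgraph_def graph_of_def by auto
  ultimately show ?thesis unfolding has_hamiltonian_cycle_def graph_of_def by fastforce
qed

section \<open>Lifting components along one step of the continued fraction\<close>

definition bd :: "int \<Rightarrow> square set" where
  "bd h = {-h..h} \<times> {-h..h}"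

definition adj :: "int \<Rightarrow> int \<Rightarrow> square \<Rightarrow> square \<Rightarrow> bool" where
  "adj p q a b \<longleftrightarrow> \<bar>fst b - fst a\<bar> = p \<and> \<bar>snd b - snd a\<bar> = q \<or>
     \<bar>fst b - fst a\<bar> = q \<and> \<bar>snd b - snd a\<bar> = p"

text \<open>A leaper is encoded by the half-width \<open>h\<close> of its board and the half-width \<open>d\<close> of the central
  square of isolated vertices. The case \<open>h = d = 0\<close> is the \<open>(0, 1)\<close>-leaper.\<close>

abbreviation ladj :: "int \<Rightarrow> int \<Rightarrow> square \<Rightarrow> square \<Rightarrow> bool" where
  "ladj h d \<equiv> adj (h - d) (h + d + 1)"

lemma mem_bd [simp]: "(x, y) \<in> bd h \<longleftrightarrow> \<bar>x\<bar> \<le> h \<and> \<bar>y\<bar> \<le> h"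
  by (auto simp: bd_def)

lemma swap_mem_bd [simp]: "prod.swap a \<in> bd h \<longleftrightarrow> a \<in> bd h"
  by (cases a) auto

lemma adj_commute: "adj p q a b \<Longrightarrow> adj p q b a"
  by (auto simp: adj_def abs_minus_commute)

lemma adj_swap [simp]: "adj p q (prod.swap a) (prod.swap b) \<longleftrightarrow> adj p q a b"
  by (auto simp: adj_def)

lemma adj_translate [simp]: "adj p q (t + a) (t + b) \<longleftrightarrow> adj p q a b"
  by (auto simp: adj_def)

text \<open>These are the unions of components of the leaper graph. Unlike single components, they
  need no connectedness argument when they are lifted.\<close>

definition closed_in :: "int \<Rightarrow> int \<Rightarrow> square set \<Rightarrow> bool" where
  "closed_in h d U \<longleftrightarrow> U \<subseteq> bd h \<and> (\<forall>u\<in>U. \<forall>v\<in>bd h. ladj h d u v \<longrightarrow> v \<in> U)"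

text \<open>With \<open>p\<close>, \<open>e\<close> and \<open>w\<close> as below, the \<open>(\<bar>e\<bar>, p)\<close>-leaper on the board of half-width \<open>hh\<close> precedes the
  \<open>(p, 2 m p + e)\<close>-leaper on the board of half-width \<open>h\<close>. Using \<open>g\<close> and \<open>g2\<close> as parameters instead of
  \<open>hh = max g g2\<close> and \<open>dd = min g g2\<close> treats both signs of \<open>e\<close> at once.\<close>

locale lift =
  fixes g g2 m :: int
  assumes g: "0 \<le> g" and g2: "0 \<le> g2" and m: "1 \<le> m"
begin

definition p :: int where "p = g + g2 + 1"
definition e :: int where "e = g - g2"
definition w :: int where "w = m * p"
definition h :: int where "h = w + g"
definition d :: int where "d = w - g2 - 1"
definition hh :: int where "hh = max g g2"
definition dd :: int where "dd = min g g2"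
text \<open>The parity is normalised so that \<open>par\<close> vanishes at \<open>m\<close> and
  \<open>- m\<close>. The extreme translates are then centred at \<open>(w, w)\<close> up to signs,
  where the row and the column families coincide.\<close>

definition par :: "int \<Rightarrow> int" where "par l = (if even (l + m) then 0 else e)"

lemma par_add_par: "par l + par (l + 1) = e"
  by (auto simp: par_def)

lemma par_diff: "\<bar>par (l + 1) - par l\<bar> = \<bar>e\<bar>"
  by (auto simp: par_def)

lemma p_pos: "0 < p" using g g2 by (simp add: p_def)

lemma w_ge: "p \<le> w"
  using mult_right_mono[OF m, of p] p_pos by (simp add: w_def)

lemmas lins = g g2 p_pos w_ge p_def e_def h_def d_def hh_def dd_def

lemma ladj_hd: "ladj h d = adj p (2 * w + e)"
proof -
  have "h - d = p" "h + d + 1 = 2 * w + e" by (auto simp: lins)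
  then show ?thesis by simp
qed

lemma ladj_hhdd: "ladj hh dd = adj \<bar>e\<bar> p"
proof -
  have "hh - dd = \<bar>e\<bar>" "hh + dd + 1 = p" by (auto simp: lins)
  then show ?thesis by simp
qed

lemma d_ge: "0 \<le> d" and d_less: "d < h" and hh_less_p: "hh < p" and hh_le: "hh \<le> h"
  using lins by auto

text \<open>The bound on \<open>\<delta> * snd a\<close> discards what a translate leaves inside the
  middle rows. It keeps \<open>F\<close> off the central square and lets \<open>a\<close> determine
  \<open>\<delta>\<close>.\<close>

definition Rh :: "square \<Rightarrow> square \<Rightarrow> bool" where
  "Rh a u \<longleftrightarrow> u \<in> bd hh \<and> a \<in> bd h \<and> (\<exists>l \<delta>. \<bar>l\<bar> \<le> m \<and> (\<delta> = 1 \<or> \<delta> = -1) \<and> fst a = fst u + l * p \<and>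
     d < \<delta> * snd a \<and> snd u = snd a - \<delta> * (w + par l))"

definition R :: "square \<Rightarrow> square \<Rightarrow> bool" where
  "R a u \<longleftrightarrow> Rh a u \<or> Rh (prod.swap a) (prod.swap u)"

lemma R_bd: "R a u \<Longrightarrow> a \<in> bd h" "R a u \<Longrightarrow> u \<in> bd hh"
  by (auto simp: R_def Rh_def)

lemma R_swap: "R (prod.swap a) (prod.swap u) \<longleftrightarrow> R a u"
  by (auto simp: R_def)

text \<open>Seen from \<open>w\<close>, the outer band extends from \<open>- g2\<close> to
  \<open>g\<close>; seen from \<open>w + e\<close>, from \<open>- g\<close> to \<open>g2\<close>.
  Both fit into half-width \<open>hh = max g g2\<close>.\<close>

lemma band_range:
  assumes "\<delta> = 1 \<or> \<delta> = -1" "\<bar>y\<bar> \<le> h" "d < \<delta> * y"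
  shows "\<bar>y - \<delta> * (w + par l)\<bar> \<le> hh"
  using assms lins by (auto simp: par_def)

lemma RhI:
  assumes "\<bar>l\<bar> \<le> m" "\<bar>x\<bar> \<le> h" "\<bar>y\<bar> \<le> h" "\<bar>x - l * p\<bar> \<le> hh" "\<delta> = 1 \<or> \<delta> = -1" "d < \<delta> * y"
  shows "Rh (x, y) (x - l * p, y - \<delta> * (w + par l))"
  unfolding Rh_def using band_range[OF assms(5,3,6), of l] assms by auto

lemma window:
  assumes "\<bar>x\<bar> \<le> h"
  obtains l where "\<bar>l\<bar> \<le> m" "\<bar>x - l * p\<bar> \<le> hh"
proof -
  obtain D M where mod: "x + g = D * p + M" "0 \<le> M" "M < p"
    using p_pos by (metis div_mult_mod_eq pos_mod_bound pos_mod_sign)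
  \<comment> \<open>The remainder puts \<open>x - D * p\<close> between \<open>- g\<close> and
    \<open>g2\<close>, hence within \<open>hh\<close>. Near the right edge \<open>D\<close> may
    exceed \<open>m\<close>, and the last window still contains \<open>x\<close>.\<close>
  define l where "l = min D m"
  have "- m \<le> D"
  proof (rule ccontr)
    assume "\<not> ?thesis"
    then have "D + 1 \<le> - m" by simp
    then have "(D + 1) * p \<le> - m * p" using p_pos by (intro mult_right_mono) auto
    then show False using mod assms by (simp add: algebra_simps h_def w_def)
  qed
  then have "\<bar>l\<bar> \<le> m" using m by (auto simp: l_def)
  moreover have "\<bar>x - l * p\<bar> \<le> hh"
  proof (cases "D \<le> m")
    case True
    then show ?thesis using mod lins by (auto simp: l_def)
  next
    case False
    then have "(m + 1) * p \<le> D * p" using p_pos by (intro mult_right_mono) auto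
    then have "x + g \<ge> w + p" using mod unfolding w_def by (simp add: distrib_right)
    then show ?thesis using False assms lins by (simp add: l_def w_def)
  qed
  ultimately show ?thesis by (rule that)
qed

text \<open>A move to the right by \<open>p\<close> passes from window \<open>l\<close> to window
  \<open>l + 1\<close>, so the quotient is now clipped at \<open>m - 1\<close>.\<close>

lemma window_step:
  assumes "\<bar>x\<bar> \<le> h" "\<bar>x + p\<bar> \<le> h"
  obtains l where "\<bar>l\<bar> \<le> m" "\<bar>l + 1\<bar> \<le> m" "\<bar>x - l * p\<bar> \<le> hh"
proof -
  obtain D M where mod: "x + g = D * p + M" "0 \<le> M" "M < p"
    using p_pos by (metis div_mult_mod_eq pos_mod_bound pos_mod_sign)
  define l where "l = min D (m - 1)"
  have "- m \<le> D"
  proof (rule ccontr)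
    assume "\<not> ?thesis"
    then have "D + 1 \<le> - m" by simp
    then have "(D + 1) * p \<le> - m * p" using p_pos by (intro mult_right_mono) auto
    then show False using mod assms by (simp add: algebra_simps h_def w_def)
  qed
  then have "\<bar>l\<bar> \<le> m" "\<bar>l + 1\<bar> \<le> m" using m by (auto simp: l_def)
  moreover have "\<bar>x - l * p\<bar> \<le> hh"
  proof (cases "D \<le> m - 1")
    case True
    then show ?thesis using mod lins by (auto simp: l_def)
  next
    case False
    then have "m * p \<le> D * p" using p_pos by (intro mult_right_mono) auto
    then have "x + g \<ge> w" using mod unfolding w_def by linarith
    moreover have "l * p = w - p" using False by (simp add: l_def w_def algebra_simps)
    ultimately show ?thesis using assms lins by simp
  qed
  ultimately show ?thesis by (rule that)
qed

lemma outer_related: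
  assumes "a \<in> bd h" "a \<notin> bd d"
  obtains u where "u \<in> bd hh" "R a u"
proof -
  obtain x y where a: "a = (x, y)" by fastforce
  have row: "\<exists>u. Rh (x, y) u" if "\<bar>x\<bar> \<le> h" "\<bar>y\<bar> \<le> h" "d < \<bar>y\<bar>" for x y
  proof -
    obtain l where l: "\<bar>l\<bar> \<le> m" "\<bar>x - l * p\<bar> \<le> hh" using window[OF \<open>\<bar>x\<bar> \<le> h\<close>] by blast
    show ?thesis
      using RhI[OF l(1) that(1,2) l(2), of "if y < 0 then -1 else 1"] that by (cases "y < 0") auto
  qed
  have "d < \<bar>x\<bar> \<or> d < \<bar>y\<bar>" using assms by (auto simp: a)
  then have "\<exists>u. R a u"
    using row[of x y] row[of y x] assms unfolding a R_def by (metis mem_bd swap_simp swap_swap)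
  then show ?thesis using that R_bd by blast
qed

text \<open>A vertical displacement of \<open>2 * w + e = h + d + 1\<close> forces the two ends into
  opposite outer bands. Since \<open>par l + par (l + 1) = e\<close>, translates \<open>l\<close>
  and \<open>l + 1\<close> then give them the same offset.\<close>

lemma step_row:
  assumes "\<bar>x\<bar> \<le> h" "\<bar>x + p\<bar> \<le> h" "\<bar>y\<bar> \<le> h" "\<bar>y'\<bar> \<le> h" "\<bar>y' - y\<bar> = 2 * w + e"
  shows "\<exists>u. Rh (x, y) u \<and> Rh (x + p, y') u"
proof -
  obtain l where l: "\<bar>l\<bar> \<le> m" "\<bar>l + 1\<bar> \<le> m" "\<bar>x - l * p\<bar> \<le> hh"
    using window_step assms by metis
  obtain \<delta> :: int where \<delta>: "\<delta> = 1 \<or> \<delta> = -1" "y' = y - \<delta> * (2 * w + e)"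
    using assms(5) by (metis abs_eq_iff' add.commute diff_add_cancel diff_minus_eq_add
        mult_1 mult_minus1 uminus_add_conv_diff)
  have hd: "h + d + 1 = 2 * w + e" by (simp add: h_def d_def e_def)
  have y: "d < \<delta> * y"
    using \<delta>(1)
  proof
    assume "\<delta> = 1" then show ?thesis using hd assms(3,4) \<delta>(2) by (simp add: abs_le_iff)
  next
    assume "\<delta> = -1" then show ?thesis using hd assms(3,4) \<delta>(2) by (simp add: abs_le_iff)
  qed
  have y': "d < (- \<delta>) * y'"
    using \<delta>(1)
  proof
    assume "\<delta> = 1" then show ?thesis using hd assms(3,4) \<delta>(2) by (simp add: abs_le_iff)
  next
    assume "\<delta> = -1" then show ?thesis using hd assms(3,4) \<delta>(2) by (simp add: abs_le_iff)
  qed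
  have "\<delta> * (2 * w + e) = \<delta> * (w + par l) + \<delta> * (w + par (l + 1))"
    unfolding par_add_par[of l, symmetric] by (simp add: algebra_simps)
  then have eqy: "y' - (- \<delta>) * (w + par (l + 1)) = y - \<delta> * (w + par l)"
    using \<delta>(2) by simp
  have eqx: "x + p - (l + 1) * p = x - l * p" by (simp add: distrib_right)
  have \<delta>': "- \<delta> = 1 \<or> - \<delta> = -1" using \<delta>(1) by auto
  have "Rh (x, y) (x - l * p, y - \<delta> * (w + par l))"
    by (rule RhI) (fact l assms \<delta> y)+
  moreover have "Rh (x + p, y') (x + p - (l + 1) * p, y' - (- \<delta>) * (w + par (l + 1)))"
    by (rule RhI) (fact l assms \<delta>' y' | simp only: eqx l)+
  ultimately show ?thesis unfolding eqx eqy by blast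
qed

lemma step_related:
  assumes "a \<in> bd h" "b \<in> bd h" "ladj h d a b"
  obtains u where "R a u" "R b u"
proof -
  have row: "\<exists>u. Rh a u \<and> Rh b u"
    if ab: "a \<in> bd h" "b \<in> bd h" "\<bar>fst b - fst a\<bar> = p" "\<bar>snd b - snd a\<bar> = 2 * w + e" for a b
  proof (cases "fst a \<le> fst b")
    case True
    then have "b = (fst a + p, snd b)" using that by (auto simp: prod_eq_iff)
    then show ?thesis
      using ab step_row[of "fst a" "snd a" "snd b"] by (metis mem_bd prod.collapse)
  next
    case False
    then have "a = (fst b + p, snd a)" using that by (auto simp: prod_eq_iff)
    then show ?thesis
      using ab step_row[of "fst b" "snd b" "snd a"] by (metis abs_minus_commute mem_bd prod.collapse)
  qed
  from assms(3) have "(\<bar>fst b - fst a\<bar> = p \<and> \<bar>snd b - snd a\<bar> = 2 * w + e) \<or>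
      (\<bar>snd b - snd a\<bar> = p \<and> \<bar>fst b - fst a\<bar> = 2 * w + e)"
    unfolding ladj_hd adj_def by auto
  then have "\<exists>u. R a u \<and> R b u"
  proof
    assume "\<bar>fst b - fst a\<bar> = p \<and> \<bar>snd b - snd a\<bar> = 2 * w + e"
    then show ?thesis using row[of a b] assms by (auto simp: R_def)
  next
    assume "\<bar>snd b - snd a\<bar> = p \<and> \<bar>fst b - fst a\<bar> = 2 * w + e"
    then have "\<exists>u. Rh (prod.swap a) u \<and> Rh (prod.swap b) u"
      using row[of "prod.swap a" "prod.swap b"] assms by (auto simp: bd_def)
    then show ?thesis unfolding R_def by (metis swap_swap)
  qed
  then show ?thesis using that by auto
qed

lemma windows_close:
  assumes "\<bar>x - l * p\<bar> \<le> hh" "\<bar>x - l' * p\<bar> \<le> hh"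
  shows "\<bar>l - l'\<bar> \<le> 1"
proof (rule ccontr)
  assume "\<not> ?thesis"
  then have "2 * p \<le> \<bar>l - l'\<bar> * p" using p_pos by (intro mult_right_mono) auto
  also have "\<bar>l - l'\<bar> * p = \<bar>(l - l') * p\<bar>" using p_pos by (simp add: abs_mult)
  also have "\<dots> \<le> 2 * hh" using assms by (simp add: algebra_simps)
  finally show False using hh_less_p by simp
qed

text \<open>Windows containing the same abscissa have equal or consecutive indices, and the centres
  of consecutive translates on one side differ by a move of the smaller leaper.\<close>

lemma Rh_unique:
  assumes "Rh a u" "Rh a v"
  shows "u = v \<or> ladj hh dd u v"
proof -
  obtain l \<delta> where u: "\<delta> = 1 \<or> \<delta> = -1" "fst a = fst u + l * p" "d < \<delta> * snd a"
      "snd u = snd a - \<delta> * (w + par l)" "u \<in> bd hh"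
    using assms(1) unfolding Rh_def by blast
  obtain l' \<delta>' where v: "\<delta>' = 1 \<or> \<delta>' = -1" "fst a = fst v + l' * p" "d < \<delta>' * snd a"
      "snd v = snd a - \<delta>' * (w + par l')" "v \<in> bd hh"
    using assms(2) unfolding Rh_def by blast
  have [simp]: "\<delta>' = \<delta>" using u(1,3) v(1,3) d_ge by auto
  have "\<bar>l - l'\<bar> \<le> 1"
    by (rule windows_close[of "fst a"]) (use u v in \<open>auto simp: bd_def\<close>)
  then consider "l = l'" | "l = l' + 1" | "l' = l + 1" by linarith
  then show ?thesis
  proof cases
    case 1 then show ?thesis using u v by (auto simp: prod_eq_iff)
  next
    case 2
    then have "\<bar>fst v - fst u\<bar> = p" "\<bar>snd v - snd u\<bar> = \<bar>e\<bar>"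
      using u v p_pos par_diff[of l'] par_diff[of l] by (auto simp: algebra_simps)
    then show ?thesis unfolding ladj_hhdd adj_def by simp
  next
    case 3
    then have "\<bar>fst v - fst u\<bar> = p" "\<bar>snd v - snd u\<bar> = \<bar>e\<bar>"
      using u v p_pos par_diff[of l'] par_diff[of l] by (auto simp: algebra_simps)
    then show ?thesis unfolding ladj_hhdd adj_def by simp
  qed
qed

text \<open>A square may be related through a row as well as through a column only if it lies in a corner
  region; the square below is then common to both.\<close>

lemma corner_related:
  assumes "\<delta> = 1 \<or> \<delta> = -1" "\<eta> = 1 \<or> \<eta> = -1" "(x, y) \<in> bd h" "d < \<eta> * x" "d < \<delta> * y"
  shows "Rh (x, y) (x - \<eta> * w, y - \<delta> * w)"
proof -
  have "\<bar>x - \<eta> * w\<bar> \<le> hh" using band_range[of \<eta> x m] assms by (auto simp: par_def)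
  moreover have "\<bar>y - \<delta> * w\<bar> \<le> hh" using band_range[of \<delta> y m] assms by (auto simp: par_def)
  moreover have "par (\<eta> * m) = 0" "\<bar>\<eta> * m\<bar> \<le> m" "\<eta> * m * p = \<eta> * w"
    using assms m by (auto simp: par_def w_def)
  ultimately show ?thesis using RhI[of "\<eta> * m" x y \<delta>] assms by auto
qed

text \<open>\<open>R\<close> is not a function, but its ambiguity stays within a component. This
  makes lifted sets closed and lifts of disjoint closed sets disjoint.\<close>

lemma related_closed:
  assumes U: "closed_in hh dd U" and "R a u" "R a v" "u \<in> U"
  shows "v \<in> U"
proof -
  have close: "z' \<in> U" if "z = z' \<or> ladj hh dd z z'" "z \<in> U" "z' \<in> bd hh" for z z'
    using that U unfolding closed_in_def by blast
  have unique: "u = v \<or> ladj hh dd u v"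
    if "Rh a u \<and> Rh a v \<or> Rh (prod.swap a) (prod.swap u) \<and> Rh (prod.swap a) (prod.swap v)" for a u v
    using that Rh_unique[of a u v] Rh_unique[of "prod.swap a" "prod.swap u" "prod.swap v"]
    by (metis adj_swap swap_swap)
  show ?thesis
  proof (cases "Rh a u \<and> Rh a v \<or> Rh (prod.swap a) (prod.swap u) \<and> Rh (prod.swap a) (prod.swap v)")
    case True
    then show ?thesis using unique[of a u v] close[of u v] assms R_bd by blast
  next
    case False
    then obtain z z' where "Rh a z" "Rh (prod.swap a) z'" using assms unfolding R_def by blast
    then obtain \<eta> \<delta> where "\<delta> = 1 \<or> \<delta> = -1" "\<eta> = 1 \<or> \<eta> = -1" "d < \<eta> * fst a" "d < \<delta> * snd a" "a \<in> bd h"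
      unfolding Rh_def by auto
    then have c: "Rh a (fst a - \<eta> * w, snd a - \<delta> * w)"
        "Rh (prod.swap a) (prod.swap (fst a - \<eta> * w, snd a - \<delta> * w))"
      using corner_related[of \<delta> \<eta> "fst a" "snd a"] corner_related[of \<eta> \<delta> "snd a" "fst a"]
      by (auto simp: prod.swap_def bd_def)
    \<comment> \<open>As \<open>c\<close> is related to \<open>a\<close> both through rows and
      through columns, \<open>Rh_unique\<close> compares it with \<open>u\<close> and with
      \<open>v\<close>, whichever way each of these arises.\<close>
    define c where "c = (fst a - \<eta> * w, snd a - \<delta> * w)"
    have "R a c" using c by (simp add: R_def c_def)
    have "u = c \<or> ladj hh dd u c" "c = v \<or> ladj hh dd c v"
      using unique[of a u c] unique[of a c v] c assms unfolding R_def c_def by blast+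
    then show ?thesis using close[of u c] close[of c v] R_bd \<open>R a c\<close> assms by blast
  qed
qed

definition F :: "square set \<Rightarrow> square set" where
  "F U = {a. \<exists>u\<in>U. R a u}"

lemma F_subset: "F U \<subseteq> bd h - bd d"
proof -
  have "a \<in> bd h - bd d" if "R a u" for a u
    using that R_bd[OF that] d_ge by (cases a) (auto simp: R_def Rh_def)
  then show ?thesis by (auto simp: F_def)
qed

lemma F_closed:
  assumes "closed_in hh dd U"
  shows "closed_in h d (F U)"
  unfolding closed_in_def
proof (intro conjI ballI impI)
  fix a b assume ab: "a \<in> F U" "b \<in> bd h" "ladj h d a b"
  have "a \<in> bd h" using ab F_subset by blast
  obtain v where "R a v" "v \<in> U" using ab by (auto simp: F_def)
  moreover obtain u where "R a u" "R b u" using step_related[OF \<open>a \<in> bd h\<close> ab(2,3)] by blast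
  ultimately show "b \<in> F U" using related_closed[OF assms] unfolding F_def by blast
qed (use F_subset in auto)

end

text \<open>The invariant behind translations. On the smaller board the borders at
  \<open>- dd\<close> and \<open>dd\<close> decide which signs are valid for a coordinate, and hence
  which zigzags occur in the lift.\<close>

definition same_region :: "int \<Rightarrow> int \<Rightarrow> int \<Rightarrow> int \<Rightarrow> bool" where
  "same_region h d z z' \<longleftrightarrow> \<bar>z\<bar> \<le> h \<and> \<bar>z'\<bar> \<le> h \<and> (z < -d \<longleftrightarrow> z' < -d) \<and> (d < z \<longleftrightarrow> d < z')"

lemma same_region_sym: "same_region h d z z' \<Longrightarrow> same_region h d z' z"
  by (auto simp: same_region_def)

text \<open>A coordinate beyond \<open>d\<close> in absolute value admits both step lengths, each
  only towards the other side; one within \<open>d\<close> admits only \<open>h - d\<close>, but in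
  both directions. Either way two moves remain.\<close>

lemma bd_outer_neighbours:
  assumes "0 \<le> d" "d < h" "a \<in> bd h" "a \<notin> bd d"
  shows "card {b \<in> bd h. ladj h d a b} = 2"
proof -
  obtain x y where a: "a = (x, y)" by fastforce
  define s :: "int \<Rightarrow> int" where "s z = (if z < 0 then 1 else -1)" for z
  have out: "\<bar>z'\<bar> \<le> h \<and> \<bar>z' - z\<bar> = h - d \<longleftrightarrow> z' = z + s z * (h - d)"
      "\<bar>z'\<bar> \<le> h \<and> \<bar>z' - z\<bar> = h + d + 1 \<longleftrightarrow> z' = z + s z * (h + d + 1)"
    if "d < \<bar>z\<bar>" "\<bar>z\<bar> \<le> h" for z z'
    using that assms(1,2) by (auto simp: s_def)
  have inn: "\<bar>z'\<bar> \<le> h \<and> \<bar>z' - z\<bar> = h - d \<longleftrightarrow> z' = z + (h - d) \<or> z' = z - (h - d)"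
      "\<not> (\<bar>z'\<bar> \<le> h \<and> \<bar>z' - z\<bar> = h + d + 1)"
    if "\<bar>z\<bar> \<le> d" for z z'
    using that assms(1,2) by auto
  have nbrs: "{b \<in> bd h. ladj h d a b} = {(x', y').
      (\<bar>x'\<bar> \<le> h \<and> \<bar>x' - x\<bar> = h - d) \<and> (\<bar>y'\<bar> \<le> h \<and> \<bar>y' - y\<bar> = h + d + 1) \<or>
      (\<bar>x'\<bar> \<le> h \<and> \<bar>x' - x\<bar> = h + d + 1) \<and> (\<bar>y'\<bar> \<le> h \<and> \<bar>y' - y\<bar> = h - d)}"
    unfolding a adj_def by auto
  have xy: "\<bar>x\<bar> \<le> h" "\<bar>y\<bar> \<le> h" "d < \<bar>x\<bar> \<or> d < \<bar>y\<bar>" using assms by (auto simp: a)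
  have ne: "s z * (h - d) \<noteq> s z * (h + d + 1)" for z using assms by (auto simp: s_def)
  consider "d < \<bar>x\<bar>" "d < \<bar>y\<bar>" | "\<bar>x\<bar> \<le> d" "d < \<bar>y\<bar>" | "d < \<bar>x\<bar>" "\<bar>y\<bar> \<le> d"
    using xy by linarith
  then show ?thesis
  proof cases
    case 1
    have "{b \<in> bd h. ladj h d a b} =
        {(x + s x * (h - d), y + s y * (h + d + 1)), (x + s x * (h + d + 1), y + s y * (h - d))}"
      unfolding nbrs out[OF 1(1) xy(1)] out[OF 1(2) xy(2)] by auto
    then show ?thesis using ne[of x] by simp
  next
    case 2
    have "{b \<in> bd h. ladj h d a b} =
        {(x + (h - d), y + s y * (h + d + 1)), (x - (h - d), y + s y * (h + d + 1))}"
      unfolding nbrs out[OF 2(2) xy(2)] inn(1)[OF 2(1)] using inn(2)[OF 2(1)] by auto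
    then show ?thesis using assms by simp
  next
    case 3
    have "{b \<in> bd h. ladj h d a b} =
        {(x + s x * (h + d + 1), y + (h - d)), (x + s x * (h + d + 1), y - (h - d))}"
      unfolding nbrs out[OF 3(1) xy(1)] inn(1)[OF 3(2)] using inn(2)[OF 3(2)] by auto
    then show ?thesis using assms by simp
  qed
qed

lemma closed_two_regular:
  assumes "0 \<le> d" "d < h" "closed_in h d S" "S \<inter> bd d = {}"
  shows "two_regular_on (ladj h d) S"
  unfolding two_regular_on_def
proof
  fix a assume "a \<in> S"
  then have "{b \<in> S. ladj h d a b} = {b \<in> bd h. ladj h d a b}" "a \<in> bd h" "a \<notin> bd d"
    using assms(3,4) by (auto simp: closed_in_def)
  then show "card {b \<in> S. ladj h d a b} = 2"
    using bd_outer_neighbours[OF assms(1,2)] by simp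
qed

section \<open>Connectedness of lifted components\<close>

context lift
begin

text \<open>The squares related to \<open>u\<close> through rows form at most two zigzag paths, one for each \<open>\<epsilon>\<close> that is valid
  for the second coordinate of \<open>u\<close>. Each of them passes through \<open>corner u \<eta> \<epsilon>\<close> for every \<open>\<eta>\<close> valid for the
  first coordinate, where it meets the corresponding zigzag through columns.\<close>

definition val :: "int \<Rightarrow> int \<Rightarrow> bool" where
  "val \<epsilon> z \<longleftrightarrow> (\<epsilon> = 1 \<or> \<epsilon> = -1) \<and> - g2 \<le> \<epsilon> * z \<and> \<epsilon> * z \<le> g"

text \<open>Successive squares of a zigzag alternate between the two bands; with this normalisation
  both extreme indices \<open>m\<close> and \<open>- m\<close> are on side
  \<open>\<epsilon>\<close>.\<close>

definition side :: "int \<Rightarrow> int \<Rightarrow> int" where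
  "side \<epsilon> l = (if even (l + m) then \<epsilon> else - \<epsilon>)"

definition zig :: "square \<Rightarrow> int \<Rightarrow> int \<Rightarrow> square" where
  "zig u \<epsilon> l = (fst u + l * p, snd u + side \<epsilon> l * (w + par l))"

definition allowed :: "int \<Rightarrow> int \<Rightarrow> bool" where
  "allowed x l \<longleftrightarrow> \<bar>l\<bar> \<le> m \<and> \<bar>x + l * p\<bar> \<le> h"

lemma side_minus [simp]: "side \<epsilon> (- l) = side \<epsilon> l"
  by (simp add: side_def)

lemma par_minus [simp]: "par (- l) = par l"
  by (simp add: par_def)

lemma ex_val: "\<bar>z\<bar> \<le> hh \<Longrightarrow> \<exists>\<epsilon>. val \<epsilon> z"
proof -
  assume "\<bar>z\<bar> \<le> hh"
  then have "val 1 z \<or> val (-1) z" using g g2 by (auto simp: val_def hh_def)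
  then show ?thesis by blast
qed

text \<open>Validity does not depend on \<open>l\<close>: changing the parity of \<open>l\<close>
  replaces \<open>\<epsilon> * z\<close> by \<open>e - \<epsilon> * z\<close>, and this reflection
  maps the interval from \<open>- g2\<close> to \<open>g\<close> to itself.\<close>

lemma val_band:
  assumes "val \<epsilon> z"
  shows "d < side \<epsilon> l * (z + side \<epsilon> l * (w + par l))" "\<bar>z + side \<epsilon> l * (w + par l)\<bar> \<le> h"
    "side \<epsilon> l = 1 \<or> side \<epsilon> l = -1"
  using assms lins by (auto simp: val_def side_def par_def)

lemma zig_Rh:
  assumes "u \<in> bd hh" "val \<epsilon> (snd u)" "allowed (fst u) l"
  shows "Rh (zig u \<epsilon> l) u"
  unfolding Rh_def using assms val_band[OF assms(2), of l]
  by (intro conjI exI[of _ l] exI[of _ "side \<epsilon> l"]) (auto simp: zig_def allowed_def)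

lemma Rh_zig:
  assumes "Rh a u"
  obtains \<epsilon> l where "val \<epsilon> (snd u)" "allowed (fst u) l" "a = zig u \<epsilon> l"
proof -
  obtain l \<delta> where l: "\<bar>l\<bar> \<le> m" "\<delta> = 1 \<or> \<delta> = -1" "fst a = fst u + l * p"
      "d < \<delta> * snd a" "snd u = snd a - \<delta> * (w + par l)" "a \<in> bd h"
    using assms unfolding Rh_def by blast
  obtain x y where a: "a = (x, y)" by fastforce
  have s: "side (side \<delta> l) l = \<delta>" by (simp add: side_def)
  have "val (side \<delta> l) (snd u)"
    using l a lins by (auto simp: val_def side_def par_def)
  moreover have "allowed (fst u) l" using l a by (auto simp: allowed_def)
  moreover have "a = zig u (side \<delta> l) l" using l s by (simp add: zig_def prod_eq_iff)
  ultimately show ?thesis by (rule that)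
qed

lemma zig_step: 
  assumes "\<epsilon> = 1 \<or> \<epsilon> = -1" shows "ladj h d (zig u \<epsilon> l) (zig u \<epsilon> (l + 1))"
proof -
  have q: "0 \<le> 2 * w + e" using lins by auto
  have "side \<epsilon> (l + 1) = - side \<epsilon> l" by (simp add: side_def)
  then have "snd (zig u \<epsilon> (l + 1)) - snd (zig u \<epsilon> l) = - side \<epsilon> l * (2 * w + e)"
    unfolding zig_def par_add_par[of l, symmetric] by (simp add: algebra_simps)
  moreover have "fst (zig u \<epsilon> (l + 1)) - fst (zig u \<epsilon> l) = p"
    by (simp add: zig_def algebra_simps)
  moreover have "\<bar>- side \<epsilon> l * (2 * w + e)\<bar> = 2 * w + e"
    using q assms by (auto simp: side_def)
  ultimately show ?thesis using p_pos unfolding ladj_hd adj_def by simp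
qed

lemma zig_reach:
  assumes "u \<in> U" "u \<in> bd hh" "val \<epsilon> (snd u)" "allowed (fst u) l" "allowed (fst u) l'"
  shows "reach (ladj h d) (F U) (zig u \<epsilon> l) (zig u \<epsilon> l')"
proof -
  have inF: "zig u \<epsilon> k \<in> F U" if "allowed (fst u) k" for k
    using zig_Rh[OF assms(2,3) that] assms(1) by (auto simp: F_def R_def)
  have mono: "reach (ladj h d) (F U) (zig u \<epsilon> l) (zig u \<epsilon> l')"
    if "l \<le> l'" "allowed (fst u) l" "allowed (fst u) l'" for l l'
    using that
  proof (induction l' rule: int_ge_induct)
    case (step k)
    \<comment> \<open>The allowed indices form an interval, so all intermediate squares of the
      zigzag are on the board.\<close>
    have "l * p \<le> k * p" using step.hyps p_pos by (intro mult_right_mono) auto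
    moreover have "\<bar>fst u + l * p\<bar> \<le> h" "\<bar>fst u + k * p + p\<bar> \<le> h" "\<bar>k\<bar> \<le> m"
      using step.prems step.hyps by (auto simp: allowed_def distrib_right add.assoc)
    ultimately have "allowed (fst u) k"
      using p_pos unfolding allowed_def by linarith
    then have "reach (ladj h d) (F U) (zig u \<epsilon> l) (zig u \<epsilon> k)" "zig u \<epsilon> k \<in> F U"
      using step inF by auto
    moreover have "zig u \<epsilon> (k + 1) \<in> F U" using step.prems inF by simp
    moreover have "ladj h d (zig u \<epsilon> k) (zig u \<epsilon> (k + 1))"
      using zig_step assms(3) by (simp add: val_def)
    ultimately show ?case using reach_trans reach_step by metis
  qed simp
  show ?thesis
  proof (cases "l \<le> l'")
    case False
    then show ?thesis using mono[of l' l] assms adj_commute by (intro reach_sym[of _ _ "zig u \<epsilon> l'"]) auto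
  qed (use mono assms in auto)
qed

definition corner :: "square \<Rightarrow> int \<Rightarrow> int \<Rightarrow> square" where
  "corner u \<eta> \<epsilon> = (fst u + \<eta> * w, snd u + \<epsilon> * w)"

lemma Rh_corner:
  assumes "Rh a u" "val \<eta> (fst u)" "u \<in> U"
  shows "\<exists>\<epsilon>. val \<epsilon> (snd u) \<and> reach (ladj h d) (F U) a (corner u \<eta> \<epsilon>)"
proof -
  obtain \<epsilon> l where z: "val \<epsilon> (snd u)" "allowed (fst u) l" "a = zig u \<epsilon> l"
    using Rh_zig assms(1) by blast
  \<comment> \<open>At index \<open>\<eta> * m\<close> the stagger vanishes and the side is
    \<open>\<epsilon>\<close>, so the zigzag is at a corner; validity of \<open>\<eta>\<close> for
    \<open>fst u\<close> keeps that corner on the board.\<close>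
  have "allowed (fst u) (\<eta> * m)"
    using val_band(2)[OF assms(2), of m] assms(2) m by (auto simp: allowed_def val_def side_def w_def par_def)
  moreover have "zig u \<epsilon> (\<eta> * m) = corner u \<eta> \<epsilon>"
    using assms(2) by (auto simp: zig_def corner_def w_def side_def par_def val_def)
  moreover have "u \<in> bd hh" using assms(1) by (simp add: Rh_def)
  ultimately show ?thesis using zig_reach[of u U \<epsilon> l "\<eta> * m"] z assms(3) by auto
qed

lemma reach_swap:
  assumes "reach (ladj h d) S a b" 
  shows "reach (ladj h d) (prod.swap ` S) (prod.swap a) (prod.swap b)"
  using assms unfolding reach_def
proof (induction rule: rtrancl_induct)
  case (step b c)
  then show ?case using adj_swap by (intro rtrancl_into_rtrancl[OF step.IH]) blast
qed simp

lemma swap_F: "prod.swap ` F U = F (prod.swap ` U)"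
proof -
  have "prod.swap a \<in> F (prod.swap ` U)" if "a \<in> F U" for a U
  proof -
    obtain u where "u \<in> U" "R a u" using \<open>a \<in> F U\<close> unfolding F_def by blast
    then have "R (prod.swap a) (prod.swap u)" "prod.swap u \<in> prod.swap ` U"
      using R_swap[of a u] by blast+
    then show ?thesis unfolding F_def by blast
  qed
  from this[of _ U] this[of _ "prod.swap ` U"] show ?thesis
    by (auto simp: image_image)
qed

text \<open>Every related square can be driven along its zigzag to a corner. From one corner to
  another, the first sign is changed along a zigzag through rows and the second along one through
  columns.\<close>

lemma fibre_connected:
  assumes "R a u" "R b u" "u \<in> U"
  shows "reach (ladj h d) (F U) a b"
proof -
  note sym = reach_sym[OF _ adj_commute]
  have u: "u \<in> bd hh" using assms R_bd by blast
  have row: "\<exists>\<epsilon>. val \<epsilon> (snd u) \<and> reach (ladj h d) (F U) a (corner u \<eta> \<epsilon>)"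
    if "Rh a u" "val \<eta> (fst u)" for a \<eta>
    using Rh_corner that assms(3) by blast
  have col: "\<exists>\<eta>. val \<eta> (fst u) \<and> reach (ladj h d) (F U) a (corner u \<eta> \<epsilon>)"
    if c: "Rh (prod.swap a) (prod.swap u)" "val \<epsilon> (snd u)" for a \<epsilon>
  proof -
    obtain \<eta> where \<eta>: "val \<eta> (fst u)"
        "reach (ladj h d) (F (prod.swap ` U)) (prod.swap a) (corner (prod.swap u) \<epsilon> \<eta>)"
      using Rh_corner[OF c(1), of \<epsilon> "prod.swap ` U"] c(2) assms(3) by auto
    from reach_swap[OF this(2)] have "reach (ladj h d) (F U) a (corner u \<eta> \<epsilon>)"
      by (simp add: swap_F image_image corner_def)
    then show ?thesis using \<eta>(1) by blast
  qed
  have corners: "reach (ladj h d) (F U) (corner u \<eta> \<epsilon>) (corner u \<eta>' \<epsilon>)"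
    if "val \<eta> (fst u)" "val \<eta>' (fst u)" "val \<epsilon> (snd u)" for \<eta> \<eta>' \<epsilon>
  proof -
    have "allowed (fst u) (\<eta> * m)" "zig u \<epsilon> (\<eta> * m) = corner u \<eta> \<epsilon>" if "val \<eta> (fst u)" for \<eta>
      using val_band(2)[OF that, of m] that m
      by (auto simp: allowed_def zig_def corner_def val_def side_def w_def par_def)
    then show ?thesis using zig_reach[OF assms(3) u that(3), of "\<eta> * m" "\<eta>' * m"] that by simp
  qed
  have corners': "reach (ladj h d) (F U) (corner u \<eta> \<epsilon>) (corner u \<eta> \<epsilon>')"
    if c: "val \<eta> (fst u)" "val \<epsilon> (snd u)" "val \<epsilon>' (snd u)" for \<eta> \<epsilon> \<epsilon>'
  proof -
    have "allowed (snd u) (\<epsilon> * m)" "zig (prod.swap u) \<eta> (\<epsilon> * m) = prod.swap (corner u \<eta> \<epsilon>)" if "val \<epsilon> (snd u)" for \<epsilon>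
      using val_band(2)[OF that, of m] that m
      by (auto simp: allowed_def zig_def corner_def val_def side_def w_def par_def)
    then have "reach (ladj h d) (F (prod.swap ` U)) (prod.swap (corner u \<eta> \<epsilon>)) (prod.swap (corner u \<eta> \<epsilon>'))"
      using zig_reach[of "prod.swap u" "prod.swap ` U" \<eta> "\<epsilon> * m" "\<epsilon>' * m"] c assms(3) u by auto
    from reach_swap[OF this] show ?thesis by (simp add: swap_F image_image)
  qed
  have to_corner: "\<exists>\<eta> \<epsilon>. val \<eta> (fst u) \<and> val \<epsilon> (snd u) \<and> reach (ladj h d) (F U) a (corner u \<eta> \<epsilon>)"
    if "R a u" for a
  proof -
    have "\<bar>fst u\<bar> \<le> hh" "\<bar>snd u\<bar> \<le> hh" using u by (auto simp: bd_def)
    then obtain \<eta> \<epsilon> where "val \<eta> (fst u)" "val \<epsilon> (snd u)" using ex_val by meson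
    then show ?thesis using row col that unfolding R_def by blast
  qed
  obtain \<eta> \<epsilon> where 1: "val \<eta> (fst u)" "val \<epsilon> (snd u)" "reach (ladj h d) (F U) a (corner u \<eta> \<epsilon>)"
    using to_corner assms(1) by blast
  obtain \<eta>' \<epsilon>' where 2: "val \<eta>' (fst u)" "val \<epsilon>' (snd u)" "reach (ladj h d) (F U) b (corner u \<eta>' \<epsilon>')"
    using to_corner assms(2) by blast
  have "reach (ladj h d) (F U) (corner u \<eta> \<epsilon>) (corner u \<eta>' \<epsilon>')"
    using reach_trans[OF corners corners'] 1 2 by blast
  then show ?thesis using reach_trans[OF 1(3) reach_trans[OF _ sym[OF 2(3)]]] by blast
qed

text \<open>For a move that is horizontal by \<open>p\<close>, put \<open>u\<close> into translate
  \<open>0\<close> and \<open>v\<close> into translate \<open>1\<close> or \<open>- 1\<close>, which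
  are available since \<open>1 \<le> m\<close>. On a suitable side the stagger cancels the vertical
  displacement from \<open>u\<close> to \<open>v\<close>.\<close>

lemma edge_shared:
  assumes "u \<in> bd hh" "v \<in> bd hh" "ladj hh dd u v"
  obtains a where "R a u" "R a v"
proof -
  have row: "\<exists>a. Rh a u \<and> Rh a v"
    if uv: "u \<in> bd hh" "v \<in> bd hh" "\<bar>fst v - fst u\<bar> = p" "\<bar>snd v - snd u\<bar> = \<bar>e\<bar>" for u v
  proof -
    obtain x y where u: "u = (x, y)" by fastforce
    obtain x' y' where v: "v = (x', y')" by fastforce
    obtain \<kappa> :: int where \<kappa>: "\<kappa> = 1 \<or> \<kappa> = -1" "x' = x + \<kappa> * p"
      using uv(3) u v p_pos by (metis abs_eq_iff abs_of_pos add.commute diff_add_cancel fst_conv mult_1 mult_minus1)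
    define \<zeta> :: int where "\<zeta> = (if y' = y + e then 1 else -1)"
    have \<zeta>: "y' = y + \<zeta> * e" using uv(4) u v by (auto simp: \<zeta>_def)
    define \<delta> where "\<delta> = side (- \<zeta>) 0"
    have b: "\<bar>y\<bar> \<le> max g g2" "\<bar>y'\<bar> \<le> max g g2" using uv(1,2) u v by (auto simp: hh_def)
    consider "\<zeta> = 1" | "\<zeta> = -1" by (metis \<zeta>_def)
    then have "val (- \<zeta>) y \<and> val \<zeta> y'"
      by cases (use b \<zeta> in \<open>auto simp: val_def e_def max_def split: if_splits\<close>)
    then have "val (- \<zeta>) y" "val \<zeta> y'" by auto
    moreover have "side \<zeta> (- \<kappa>) = \<delta>" using \<kappa> by (auto simp: side_def \<delta>_def)
    moreover have "y + \<delta> * (w + par 0) = y' + \<delta> * (w + par (- \<kappa>))"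
      using \<zeta> \<kappa> by (auto simp: par_def \<delta>_def side_def \<zeta>_def algebra_simps)
    ultimately have "zig u (- \<zeta>) 0 = zig v \<zeta> (- \<kappa>)"
      using \<kappa> by (simp add: zig_def u v \<delta>_def)
    moreover have "allowed x 0" "allowed x' (- \<kappa>)"
      using uv(1) u hh_le m \<kappa> by (auto simp: allowed_def)
    ultimately show ?thesis
      using zig_Rh[of u "- \<zeta>" 0] zig_Rh[of v \<zeta> "- \<kappa>"] uv \<open>val (- \<zeta>) y\<close> \<open>val \<zeta> y'\<close> u v
      by (metis fst_conv snd_conv)
  qed
  from assms(3) have "(\<bar>fst v - fst u\<bar> = p \<and> \<bar>snd v - snd u\<bar> = \<bar>e\<bar>) \<or>
      (\<bar>snd v - snd u\<bar> = p \<and> \<bar>fst v - fst u\<bar> = \<bar>e\<bar>)"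
    unfolding ladj_hhdd adj_def by auto
  then have "\<exists>a. R a u \<and> R a v"
  proof
    assume "\<bar>fst v - fst u\<bar> = p \<and> \<bar>snd v - snd u\<bar> = \<bar>e\<bar>"
    then show ?thesis using row[of u v] assms by (auto simp: R_def)
  next
    assume "\<bar>snd v - snd u\<bar> = p \<and> \<bar>fst v - fst u\<bar> = \<bar>e\<bar>"
    then have "\<exists>a. Rh a (prod.swap u) \<and> Rh a (prod.swap v)"
      using row[of "prod.swap u" "prod.swap v"] assms by auto
    then show ?thesis unfolding R_def by (metis swap_swap)
  qed
  then show ?thesis using that by auto
qed

text \<open>Along a path in \<open>U\<close>, \<open>edge_shared\<close> joins the fibres of
  consecutive squares and \<open>fibre_connected\<close> moves within each fibre.\<close>

lemma F_connected:
  assumes "U \<subseteq> bd hh" "connected_on (ladj hh dd) U"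
  shows "connected_on (ladj h d) (F U)"
proof -
  have "\<forall>b. R b v \<longrightarrow> reach (ladj h d) (F U) a b" if "R a u" "u \<in> U" "reach (ladj hh dd) U u v" for a u v
    using that(3) unfolding reach_def[of "ladj hh dd"]
  proof (induction rule: rtrancl_induct)
    case base
    then show ?case using fibre_connected that by blast
  next
    case (step v v')
    then have v: "v \<in> U" "v' \<in> U" "ladj hh dd v v'" by auto
    then obtain c where "R c v" "R c v'" using edge_shared assms(1) by blast
    then show ?case
      using reach_trans[OF step.IH[rule_format] fibre_connected[of c v' _ U]] v by blast
  qed
  then show ?thesis using assms(2) unfolding connected_on_def F_def by blast
qed

text \<open>By \<open>related_closed\<close>, any one window containing the square decides
  membership, in spite of the overlaps.\<close>

lemma F_mem_row:
  assumes "closed_in hh dd U" "\<bar>x\<bar> \<le> h" "\<bar>y\<bar> \<le> h" "\<bar>l\<bar> \<le> m" "\<bar>x - l * p\<bar> \<le> hh" "\<delta> = 1 \<or> \<delta> = -1" "d < \<delta> * y"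
  shows "(x, y) \<in> F U \<longleftrightarrow> (x - l * p, y - \<delta> * (w + par l)) \<in> U"
proof -
  have "R (x, y) (x - l * p, y - \<delta> * (w + par l))"
    using RhI[OF assms(4,2,3,5-7)] by (simp add: R_def)
  then show ?thesis using related_closed[OF assms(1)] unfolding F_def by blast
qed

text \<open>The mirror image negates \<open>l\<close> in a relation through rows and
  \<open>\<delta>\<close> in one through columns.\<close>

lemma F_flip:
  assumes "\<And>x y. (x, y) \<in> U \<Longrightarrow> (- x, y) \<in> U" "\<And>x y. (x, y) \<in> U \<Longrightarrow> (x, - y) \<in> U" "(x, y) \<in> F U"
  shows "(- x, y) \<in> F U"
proof -
  have row1: "Rh (- fst a, snd a) (- fst u, snd u)" if r: "Rh a u" for a u
  proof -
    obtain \<epsilon> l where z: "val \<epsilon> (snd u)" "allowed (fst u) l" "a = zig u \<epsilon> l"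
      using Rh_zig[OF r] by blast
    have "u \<in> bd hh" using r by (simp add: Rh_def)
    note z = z this
    then have "Rh (zig (- fst u, snd u) \<epsilon> (- l)) (- fst u, snd u)"
      by (intro zig_Rh) (auto simp: allowed_def bd_def)
    then show ?thesis using z(3) by (simp add: zig_def)
  qed
  have row2: "Rh (fst a, - snd a) (fst u, - snd u)" if r: "Rh a u" for a u
  proof -
    obtain l \<delta> where l: "\<bar>l\<bar> \<le> m" "\<delta> = 1 \<or> \<delta> = -1" "fst a = fst u + l * p"
        "d < \<delta> * snd a" "snd u = snd a - \<delta> * (w + par l)" "a \<in> bd h" "u \<in> bd hh"
      using r unfolding Rh_def by blast
    then show ?thesis unfolding Rh_def
      by (intro conjI exI[of _ l] exI[of _ "- \<delta>"]) (auto simp: bd_def)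
  qed
  obtain u where u: "u \<in> U" "Rh (x, y) u \<or> Rh (y, x) (snd u, fst u)"
    using assms(3) by (auto simp: F_def R_def prod.swap_def)
  then have "R (- x, y) (- fst u, snd u)"
    using row1[of "(x, y)" u] row2[of "(y, x)" "(snd u, fst u)"] by (auto simp: R_def)
  moreover have "(- fst u, snd u) \<in> U" using assms(1)[of "fst u" "snd u"] u by simp
  ultimately show ?thesis by (auto simp: F_def)
qed

section \<open>Compatibility of the lift with translations\<close>

lemma same_region_val: "same_region hh dd z z' \<Longrightarrow> val \<epsilon> z \<Longrightarrow> val \<epsilon> z'"
  using g g2 by (auto simp: same_region_def val_def hh_def dd_def split: if_splits)

text \<open>Only indices close to \<open>m\<close> or \<open>- m\<close> bring a coordinate near the
  borders at \<open>- d\<close> and \<open>d\<close>, and for these \<open>l * p\<close> is known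
  exactly. If \<open>\<bar>l\<bar> \<le> m - 2\<close>, everything stays in the middle.\<close>

lemma same_region_lift:
  assumes "same_region hh dd z z'" "\<bar>l\<bar> \<le> m" "\<bar>z + l * p\<bar> \<le> h"
  shows "same_region h d (z + l * p) (z' + l * p)"
proof -
  have sr: "\<bar>z\<bar> < p" "\<bar>z'\<bar> < p" "z \<le> g \<longleftrightarrow> z' \<le> g" "z \<le> g2 \<longleftrightarrow> z' \<le> g2"
      "- g \<le> z \<longleftrightarrow> - g \<le> z'" "- g2 \<le> z \<longleftrightarrow> - g2 \<le> z'"
    using assms(1) g g2 unfolding same_region_def hh_def dd_def p_def
    by (cases "g \<le> g2"; simp; linarith)+
  consider "l = m" | "l = -m" | "l = m - 1" "m > 1" | "l = 1 - m" "m > 1" | "l = 0" "m = 1" | "\<bar>l\<bar> \<le> m - 2"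
    using assms(2) m by linarith
  then show ?thesis
  proof cases
    case 1
    then have "l * p = w" by (simp add: w_def)
    then show ?thesis using assms(3) sr w_ge g g2 unfolding same_region_def h_def d_def p_def by (smt (verit))
  next
    case 2
    then have "l * p = - w" by (simp add: w_def)
    then show ?thesis using assms(3) sr w_ge g g2 unfolding same_region_def h_def d_def p_def by (smt (verit))
  next
    case 3
    then have "l * p = w - p" "2 * p \<le> w"
      using mult_right_mono[of 2 m p] p_pos by (auto simp: w_def algebra_simps)
    then show ?thesis using assms(3) sr w_ge g g2 unfolding same_region_def h_def d_def p_def by (smt (verit))
  next
    case 4
    then have "l * p = p - w" "2 * p \<le> w"
      using mult_right_mono[of 2 m p] p_pos by (auto simp: w_def left_diff_distrib)
    then show ?thesis using assms(3) sr w_ge g g2 unfolding same_region_def h_def d_def p_def by (smt (verit))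
  next
    case 5
    then have "l * p = 0" "w = p" unfolding w_def by simp_all
    then show ?thesis using assms(3) sr w_ge g g2 unfolding same_region_def h_def d_def p_def by (smt (verit))
  next
    case 6
    then have "l * p \<le> (m - 2) * p" "(2 - m) * p \<le> l * p"
      using p_pos by (auto intro!: mult_right_mono)
    then have "\<bar>l * p\<bar> \<le> w - 2 * p" by (auto simp: w_def algebra_simps)
    then show ?thesis using assms(3) sr w_ge g g2 unfolding same_region_def h_def d_def p_def by (smt (verit))
  qed
qed

lemma Rh_translate:
  assumes "Rh a u" "same_region hh dd (fst u) (fst (t + u))" "same_region hh dd (snd u) (snd (t + u))"
  shows "Rh (t + a) (t + u)" "same_region h d (fst a) (fst (t + a))" "same_region h d (snd a) (snd (t + a))"
proof -
  obtain \<epsilon> l where z: "val \<epsilon> (snd u)" "allowed (fst u) l" "a = zig u \<epsilon> l" "u \<in> bd hh"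
    using Rh_zig[OF assms(1)] assms(1) by (metis Rh_def)
  have v: "val \<epsilon> (snd (t + u))" using same_region_val assms(3) z(1) by blast
  have ta: "t + a = zig (t + u) \<epsilon> l" by (simp add: z(3) zig_def prod_eq_iff)
  have s: "same_region h d (fst u + l * p) (fst (t + u) + l * p)"
    using same_region_lift[OF assms(2)] z(2) by (auto simp: allowed_def)
  then have "allowed (fst (t + u)) l" using z(2) by (auto simp: allowed_def same_region_def)
  moreover have "t + u \<in> bd hh"
    using assms(2,3) by (cases "t + u") (auto simp: same_region_def)
  ultimately show "Rh (t + a) (t + u)" using zig_Rh v ta by metis
  show "same_region h d (fst a) (fst (t + a))" using s by (simp add: ta z(3) zig_def add.assoc)
  show "same_region h d (snd a) (snd (t + a))"
    unfolding ta z(3) zig_def snd_conv using val_band[OF v, of l] val_band[OF z(1), of l] d_ge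
    by (auto simp: same_region_def)
qed

lemma F_translate:
  assumes "\<And>u. u \<in> U \<Longrightarrow> same_region hh dd (fst u) (fst (t + u)) \<and> same_region hh dd (snd u) (snd (t + u))"
  shows "F ((+) t ` U) = (+) t ` F U"
    and "a \<in> F U \<Longrightarrow> same_region h d (fst a) (fst (t + a)) \<and> same_region h d (snd a) (snd (t + a))"
proof -
  have st: "prod.swap (t + a) = prod.swap t + prod.swap a" for t a :: square
    by (simp add: prod_eq_iff)
  have tr: "R (t + a) (t + u) \<and> same_region h d (fst a) (fst (t + a)) \<and> same_region h d (snd a) (snd (t + a))"
    if "R a u" "same_region hh dd (fst u) (fst (t + u))" "same_region hh dd (snd u) (snd (t + u))" for a u t
    using that Rh_translate[of a u t] Rh_translate[of "prod.swap a" "prod.swap u" "prod.swap t"]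
    unfolding R_def st[symmetric] by auto
  show "a \<in> F U \<Longrightarrow> same_region h d (fst a) (fst (t + a)) \<and> same_region h d (snd a) (snd (t + a))"
    using tr assms unfolding F_def by blast
  show "F ((+) t ` U) = (+) t ` F U"
  proof
    show "(+) t ` F U \<subseteq> F ((+) t ` U)"
    proof
      fix b assume "b \<in> (+) t ` F U"
      then obtain a u where "b = t + a" "u \<in> U" "R a u" unfolding F_def by blast
      then have "R b (t + u)" using tr assms by blast
      then show "b \<in> F ((+) t ` U)" using \<open>u \<in> U\<close> unfolding F_def by blast
    qed
    show "F ((+) t ` U) \<subseteq> (+) t ` F U"
    proof
      fix b assume "b \<in> F ((+) t ` U)"
      then obtain u where u: "u \<in> U" "R b (t + u)" by (auto simp: F_def)
      have "R (- t + b) (- t + (t + u))"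
        using tr[OF u(2), of "- t"] assms[OF u(1)] same_region_sym by simp
      then have "- t + b \<in> F U" using u(1) by (auto simp: F_def)
      then show "b \<in> (+) t ` F U" by (metis (no_types) add_minus_cancel imageI)
    qed
  qed
qed

end

section \<open>The second leaper\<close>

definition flipx :: "square \<Rightarrow> square" where "flipx v = (- fst v, snd v)"
definition flipy :: "square \<Rightarrow> square" where "flipy v = (fst v, - snd v)"
definition rot :: "square \<Rightarrow> square" where "rot v = (- snd v, fst v)"

lemmas flip_defs = flipx_def flipy_def rot_def

lemma adj_rot [simp]: "adj r s (rot a) (rot b) \<longleftrightarrow> adj r s a b"
  by (auto simp: adj_def rot_def abs_minus_commute)

lemma adj_flipy [simp]: "adj r s (flipy a) (flipy b) \<longleftrightarrow> adj r s a b"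
  by (auto simp: adj_def flipy_def abs_minus_commute)

lemma flipy_flipy: "flipy (flipy v) = v"
  by (simp add: flipy_def)

lemma successively_overlap:
  assumes "successively P (xs @ ys)" "successively P (ys @ zs)" "ys \<noteq> []"
  shows "successively P (xs @ ys @ zs)"
  using assms by (auto simp: successively_append_iff)

lemma successively_map_iff:
  assumes "\<And>a b. P (f a) (f b) \<longleftrightarrow> P a b"
  shows "successively P (map f xs) \<longleftrightarrow> successively P xs"
  by (simp add: successively_map assms)

lemma distinct_concat_map:
  assumes "distinct xs" "\<And>i. i \<in> set xs \<Longrightarrow> distinct (f i)" "\<And>i v. i \<in> set xs \<Longrightarrow> v \<in> set (f i) \<Longrightarrow> k v = i"
  shows "distinct (concat (map f xs))"
  using assms
proof (induction xs)
  case (Cons x xs)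
  have "set (f x) \<inter> set (concat (map f xs)) = {}"
  proof (rule equals0I)
    fix v assume "v \<in> set (f x) \<inter> set (concat (map f xs))"
    then obtain i where "i \<in> set xs" "v \<in> set (f i)" "v \<in> set (f x)" by auto
    then have "i = x" using Cons.prems(3)[of i v] Cons.prems(3)[of x v] by simp
    then show False using Cons.prems(1) \<open>i \<in> set xs\<close> by simp
  qed
  then show ?case using Cons by auto
qed simp

lemma rev_upto: "rev [a..b] = map uminus [- b..- a]"
proof (induction a b rule: upto.induct)
  case (1 a b)
  show ?case
  proof (cases "a \<le> b")
    case True
    have "- (a + 1) = - a - 1" by simp
    then show ?thesis
      using True 1[OF True] upto_rec1[OF True] upto_rec2[of "- b" "- a"] by (simp only: rev.simps) simp
  qed simp
qed

lemma map_add_upto: "map (\<lambda>i. i + c) [a..b] = [a + c..b + c]" for c :: int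
proof (induction a b rule: upto.induct)
  case (1 a b)
  show ?case
  proof (cases "a \<le> b")
    case True
    then show ?thesis
      using 1[OF True] upto_rec1[OF True] upto_rec1[of "a + c" "b + c"] by (simp add: algebra_simps)
  qed simp
qed

text \<open>A tour of a symmetric set \<open>C\<close> by the \<open>(r, s)\<close>-leaper: \<open>K\<close> visits the lower left corner region, \<open>N\<close> the
  region along the lower side, and the rotations of \<open>K @ N\<close> by quarter turns complete the tour. The
  assumption on \<open>rev (K @ N)\<close> is what makes neighbouring translates of the tour overlap in the lift.\<close>

locale quarter =
  fixes h d r s :: int and C :: "square set" and K N :: "square list"
  assumes d: "0 \<le> d"
    and C_swap: "\<And>v. v \<in> C \<Longrightarrow> prod.swap v \<in> C"
    and C_flipx: "\<And>v. v \<in> C \<Longrightarrow> flipx v \<in> C"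
    and C_sub: "C \<subseteq> bd h" "C \<inter> bd d = {}"
    and set_K: "set K = {v \<in> C. fst v < - d \<and> snd v < - d}"
    and set_N: "set N = {v \<in> C. \<bar>fst v\<bar> \<le> d \<and> snd v < - d}"
    and K_ne: "K \<noteq> []" and N_ne: "N \<noteq> []"
    and distinct: "distinct K" "distinct N"
    and rev_K: "rev K = map prod.swap K" and rev_N: "rev N = map flipx N"
    and rev_KN: "rev (K @ N) = map (\<lambda>v. (- (h - d), - (h + d + 1)) - v) (K @ N)"
    and path: "successively (adj r s) (K @ N @ map rot K)"
begin

lemma C_rot: "v \<in> C \<Longrightarrow> rot v \<in> C"
  using C_flipx[OF C_swap[of v]] by (simp add: rot_def flipx_def)

lemma C_flipy: "v \<in> C \<Longrightarrow> flipy v \<in> C"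
  using C_swap[OF C_flipx[OF C_swap[of v]]] by (simp add: flipy_def flipx_def prod.swap_def)

text \<open>\<open>K @ N\<close> fills the part of \<open>C\<close> in the rectangle of abscissae up
  to \<open>d\<close> below the central square. Its four rotations tile the frame around that square
  like a pinwheel.\<close>

lemma hamiltonian: "has_hamiltonian_cycle (graph_of (adj r s) C)"
proof -
  define A where "A = K @ N"
  define V where "V = A @ map rot A @ map (rot \<circ> rot) A @ map (rot \<circ> rot \<circ> rot) A"
  have A: "set A = {v \<in> C. snd v < - d \<and> fst v \<le> d}" "A \<noteq> []" "distinct A"
    using d K_ne distinct by (auto simp: A_def set_K set_N)
  have inj: "inj_on f B" if "\<And>v. f' (f v) = v" for f f' :: "square \<Rightarrow> square" and B
    using that by (metis inj_onI)
  have inj_rot: "inj_on rot B" "inj_on (rot \<circ> rot) B" "inj_on (rot \<circ> rot \<circ> rot) B" for B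
    by (rule inj[of "rot \<circ> rot \<circ> rot"] inj[of "rot \<circ> rot"] inj[of rot]; simp add: rot_def)+
  have dist: "distinct V"
    using A(3) inj_rot d by (auto simp: V_def distinct_map A(1) rot_def)
  have V: "set V = C"
  proof
    show "set V \<subseteq> C" by (auto simp: V_def A(1) intro!: C_rot)
    show "C \<subseteq> set V"
    proof
      fix v assume v: "v \<in> C"
      have "v = rot (rot (rot (rot v)))" by (simp add: rot_def)
      moreover have "v \<in> set A \<or> rot v \<in> set A \<or> rot (rot v) \<in> set A \<or> rot (rot (rot v)) \<in> set A"
      proof -
        obtain x y where xy: "v = (x, y)" by fastforce
        have "d < \<bar>x\<bar> \<or> d < \<bar>y\<bar>" using v C_sub by (auto simp: xy)
        then have "y < - d \<and> x \<le> d \<or> x < - d \<and> - y \<le> d \<or> - y < - d \<and> - x \<le> d \<or> - x < - d \<and> y \<le> d"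
          using d by arith
        moreover have "rot v \<in> C" "rot (rot v) \<in> C" "rot (rot (rot v)) \<in> C"
          using v by (simp_all add: C_rot)
        ultimately show ?thesis unfolding A(1) using v by (simp add: xy rot_def)
      qed
      ultimately show "v \<in> set V" unfolding V_def
        by (auto simp: image_iff)
    qed
  qed
  have pA: "successively (adj r s) A" and link: "adj r s (last A) (rot (hd A))"
    using path K_ne N_ne by (auto simp: A_def successively_append_iff hd_map)
  have "successively (adj r s) (map f A)" if "\<And>a b. adj r s (f a) (f b) \<longleftrightarrow> adj r s a b" for f
    using pA successively_map_iff[of "adj r s" f, OF that] by simp
  then have "successively (adj r s) V"
    using pA link A(2) by (auto simp: V_def successively_append_iff hd_map last_map hd_append last_append)
  moreover have "adj r s (last V) (hd V)"
  proof -
    have "adj r s (rot (rot (rot (last A)))) (rot (rot (rot (rot (hd A)))))" using link by simp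
    moreover have "rot (rot (rot (rot (hd A)))) = hd A" by (simp add: rot_def)
    ultimately show ?thesis using A(2) by (simp add: V_def last_map)
  qed
  moreover have "length V \<ge> 3" using A(2) by (cases A) (auto simp: V_def)
  ultimately show ?thesis using closed_path_hamiltonian[OF dist] V by metis
qed

end

text \<open>\<open>H\<close> and \<open>J\<close> are the middle and the right part of the arc of the smaller tour that is used in every
  other translate; the remaining translates use its mirror image. The assumption on \<open>rev J\<close> says that
  the right part in one translate is the left part in the next one. For an isolated vertex \<open>J\<close> is empty.\<close>

locale band = lift +
  fixes C' :: "square set" and H J :: "square list" and r s :: int
  assumes C'_closed: "closed_in hh dd C'"
    and C'_swap: "\<And>v. v \<in> C' \<Longrightarrow> prod.swap v \<in> C'"
    and C'_flipx: "\<And>v. v \<in> C' \<Longrightarrow> flipx v \<in> C'"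
    and set_H: "set H = {v \<in> C'. \<bar>fst v\<bar> \<le> dd \<and> - g \<le> snd v \<and> snd v \<le> g2}"
    and set_J: "set J = {v \<in> C'. dd < fst v \<and> - g \<le> snd v \<and> snd v \<le> g2}"
    and H_ne: "H \<noteq> []" and dist: "distinct H" "distinct J"
    and rev_H: "rev H = map flipx H"
    and rev_J: "rev J = map (\<lambda>v. (p, - e) + flipy (flipx v)) J"
    and path: "successively (adj r s) (H @ J @ map (\<lambda>v. (p, - e) + flipy v) H)"
    and corner_l: "g2 < g \<Longrightarrow> rev (rev (map flipx J) @ H) = map prod.swap (rev (map flipx J) @ H)"
    and corner_r: "g \<le> g2 \<Longrightarrow> rev (H @ J) = map prod.swap (H @ J)"
begin

section \<open>The path of glued arcs along the lower side\<close>

lemma C'_bd: "(x, y) \<in> C' \<Longrightarrow> \<bar>x\<bar> \<le> hh \<and> \<bar>y\<bar> \<le> hh"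
  using C'_closed unfolding closed_in_def by (metis mem_bd subsetD)

lemma F_bd: "(x, y) \<in> F U \<Longrightarrow> \<bar>x\<bar> \<le> h \<and> \<bar>y\<bar> \<le> h"
  using F_subset by (metis DiffD1 mem_bd subsetD)

lemma C'_flipy: "v \<in> C' \<Longrightarrow> flipy v \<in> C'"
  using C'_swap[OF C'_flipx[OF C'_swap[of v]]] by (simp add: flipy_def flipx_def prod.swap_def)

text \<open>The lower band cuts the translate at heights from \<open>- g\<close> to
  \<open>g2\<close> if \<open>l + m\<close> is even and from \<open>- g2\<close> to \<open>g\<close>
  otherwise; reflecting the latter lets one arc serve for both.\<close>

definition place :: "int \<Rightarrow> square \<Rightarrow> square" where
  "place l v = (l * p, - (w + par l)) + (if even (l + m) then v else flipy v)"

text \<open>Even indices stand for middle parts of translates, odd ones for the overlap of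
  translates \<open>i div 2\<close> and \<open>i div 2 + 1\<close>.\<close>

definition X :: "int \<Rightarrow> square list" where
  "X i = map (place (i div 2)) (if even i then H else J)"

definition Y :: "int \<Rightarrow> int \<Rightarrow> square list" where
  "Y a b = concat (map X [a..b])"

lemma X_even: "X (2 * l) = map (place l) H" and X_odd: "X (2 * l + 1) = map (place l) J"
  by (simp_all add: X_def)

text \<open>One translate further, the arc is carried along by a glide reflection whose axis is the
  middle line of the lower band.\<close>

lemma X_add_2: "X (i + 2) = map (\<lambda>v. (p + fst v, - (2 * w + e) - snd v)) (X i)"
proof -
  have "(i + 2) div 2 = i div 2 + 1" by simp
  then show ?thesis
    by (auto simp: X_def place_def flipy_def par_def prod_eq_iff algebra_simps)
qed

lemma rev_X: "rev (X i) = map flipx (X (- i))"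
proof (cases "even i")
  case True
  then obtain l where l: "i = 2 * l" by blast
  have "- i = 2 * (- l)" using l by simp
  then have "map flipx (X (- i)) = map (\<lambda>v. flipx (place (- l) v)) H"
    unfolding l by (simp only: X_even map_map comp_def)
  moreover have "rev (X i) = map (\<lambda>v. place l (flipx v)) H"
    unfolding l X_even rev_map rev_H by simp
  moreover have "place l (flipx v) = flipx (place (- l) v)" for v
    by (auto simp: place_def flip_defs)
  ultimately show ?thesis by simp
next
  case False
  then obtain l where l: "i = 2 * l + 1" by (elim oddE)
  \<comment> \<open>The mirror image of the overlap of translates \<open>l\<close> and
    \<open>l + 1\<close> is the overlap of \<open>- l - 1\<close> and \<open>- l\<close>.\<close>
  have "- i = 2 * (- l - 1) + 1" using l by simp
  then have "map flipx (X (- i)) = map (\<lambda>v. flipx (place (- l - 1) v)) J"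
    unfolding l by (simp only: X_odd map_map comp_def)
  moreover have "rev (X i) = map (\<lambda>v. place l ((p, - e) + flipy (flipx v))) J"
    unfolding l X_odd rev_map rev_J by simp
  moreover have "place l ((p, - e) + flipy (flipx v)) = flipx (place (- l - 1) v)" for v
    by (auto simp: place_def flip_defs par_def algebra_simps)
  ultimately show ?thesis by simp
qed

lemma rev_Y: "rev (Y a b) = map flipx (Y (- b) (- a))"
  by (simp add: Y_def rev_concat rev_map rev_upto map_concat rev_X comp_def)

lemma Y_add_2: "Y (a + 2) (b + 2) = map (\<lambda>v. (p + fst v, - (2 * w + e) - snd v)) (Y a b)"
  by (simp add: Y_def map_concat X_add_2 comp_def flip: map_add_upto)

lemma Y_split: "a \<le> b + 1 \<Longrightarrow> b \<le> c \<Longrightarrow> Y a c = Y a b @ Y (b + 1) c"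
proof -
  assume "a \<le> b + 1" "b \<le> c"
  then have "[a..c] = [a..b] @ [b + 1..c]"
    using upto_split1[of a "b + 1" c] by (cases "b = c") auto
  then show ?thesis by (simp add: Y_def)
qed

lemma Y_single: "Y a a = X a" and Y_pair: "Y a (a + 1) = X a @ X (a + 1)"
  by (simp_all add: Y_def upto_rec1)

lemma adj_place: "adj r s (place l a) (place l b) \<longleftrightarrow> adj r s a b"
  by (simp add: place_def)

lemma path_Y:
  assumes "a \<le> b"
  shows "successively (adj r s) (Y (2 * a) (2 * b))"
  using assms
proof (induction b rule: int_ge_induct)
  case base
  show ?case using path
    by (simp add: Y_single X_even successively_map_iff adj_place successively_append_iff)
next
  case (step b)
  have "X (2 * b + 2) = map (place b) (map (\<lambda>v. (p, - e) + flipy v) H)"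
    unfolding X_add_2 X_even
    by (auto simp: place_def flip_defs par_def)
  then have "X (2 * b) @ X (2 * b + 1) @ X (2 * b + 2) =
      map (place b) (H @ J @ map (\<lambda>v. (p, - e) + flipy v) H)"
    by (simp add: X_even X_odd)
  then have "successively (adj r s) (X (2 * b) @ X (2 * b + 1) @ X (2 * b + 2))"
    using path by (simp only: successively_map_iff[of "adj r s", OF adj_place])
  moreover have "X (2 * b) \<noteq> []" using H_ne by (simp add: X_even)
  moreover have "Y (2 * a) (2 * b) = Y (2 * a) (2 * b - 1) @ X (2 * b)"
    using Y_split[of "2 * a" "2 * b - 1" "2 * b"] step.hyps by (simp add: Y_single)
  moreover have "Y (2 * a) (2 * (b + 1)) = Y (2 * a) (2 * b) @ X (2 * b + 1) @ X (2 * b + 2)"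
    using Y_split[of "2 * a" "2 * b" "2 * b + 2"] Y_pair[of "2 * b + 1"] step.hyps by (simp add: algebra_simps)
  ultimately show ?case
    using step.IH successively_overlap[of "adj r s" "Y (2 * a) (2 * b - 1)" "X (2 * b)" "X (2 * b + 1) @ X (2 * b + 2)"]
    by simp
qed

text \<open>The sets \<open>set (X i)\<close> occupy consecutive vertical strips; \<open>idx x\<close> is the index of the strip containing
  the abscissa \<open>x\<close>.\<close>

definition idx :: "int \<Rightarrow> int" where
  "idx x = (let l = (x + dd) div p in 2 * l + (if dd < x - l * p then 1 else 0))"

lemma p_eq: "p = hh + dd + 1"
  by (auto simp: p_def hh_def dd_def)

text \<open>The reflection in \<open>place\<close> disappears because \<open>C'\<close> is
  symmetric, and for either parity the cut from \<open>- g\<close> to \<open>g2\<close> becomes the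
  lower band of the board.\<close>

lemma mem_X:
  "(x, y) \<in> set (X i) \<longleftrightarrow> (x - i div 2 * p, y + (w + par (i div 2))) \<in> C' \<and>
     (if even i then \<bar>x - i div 2 * p\<bar> \<le> dd else dd < x - i div 2 * p) \<and> - h \<le> y \<and> y < - d"
proof -
  define l where "l = i div 2"
  let ?v = "(x - l * p, y + (w + par l))"
  define u where "u = (if even (l + m) then ?v else flipy ?v)"
  have pl: "place l v = (x, y) \<longleftrightarrow> v = u" for v
    by (cases v) (auto simp: place_def u_def flip_defs)
  have "(x, y) \<in> set (X i) \<longleftrightarrow> u \<in> set (if even i then H else J)"
    by (auto simp: X_def l_def[symmetric] image_iff pl eq_commute[of "(x, y)"])
  moreover have "u \<in> C' \<longleftrightarrow> ?v \<in> C'"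
    using C'_flipy[of ?v] C'_flipy[of "flipy ?v"] flipy_flipy[of ?v] unfolding u_def by metis
  moreover have "fst u = x - l * p" by (simp add: u_def flipy_def)
  moreover have "- g \<le> snd u \<and> snd u \<le> g2 \<longleftrightarrow> - h \<le> y \<and> y < - d"
    by (auto simp: u_def flipy_def par_def h_def d_def e_def)
  ultimately show ?thesis by (auto simp: set_H set_J l_def)
qed

lemma idx_X: "v \<in> set (X i) \<Longrightarrow> idx (fst v) = i"
proof -
  assume v: "v \<in> set (X i)"
  obtain x y where xy: "v = (x, y)" by fastforce
  define l where "l = i div 2"
  have m: "(x - l * p, y + (w + par l)) \<in> C'" "if even i then \<bar>x - l * p\<bar> \<le> dd else dd < x - l * p"
    using v unfolding xy mem_X l_def by auto
  then have "\<bar>x - l * p\<bar> \<le> hh" using C'_bd by blast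
  moreover have "0 \<le> dd" using g g2 by (simp add: dd_def)
  ultimately have "0 \<le> x + dd - l * p" "x + dd - l * p < p"
    using m(2) p_eq by (cases "even i"; simp; linarith)+
  then have "(x + dd - l * p) div p = 0" by simp
  then have "(x + dd) div p = l" using p_pos div_add_self1
    by (metis add.left_neutral diff_add_cancel div_mult_self1 less_irrefl add.commute)
  moreover have "i = 2 * l + (if even i then 0 else 1)" unfolding l_def by auto
  ultimately show ?thesis using m(2) by (cases "even i") (simp_all add: idx_def xy Let_def)
qed

lemma distinct_Y: "distinct (Y a b)"
proof -
  have "inj (place l)" for l
    by (rule injI) (auto simp: place_def flipy_def prod_eq_iff split: if_splits)
  then have "distinct (X i)" for i using dist by (auto simp: X_def distinct_map inj_on_def inj_def)
  then show ?thesis unfolding Y_def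
    by (intro distinct_concat_map[where k = "idx \<circ> fst"]) (auto simp: idx_X)
qed

text \<open>The left part of the leftmost arc belongs to the board only if \<open>e > 0\<close>.\<close>

definition b where "b = (if g2 < g then 1 else 0 :: int)"

text \<open>In translate \<open>- m\<close>, these two strips are the left and the middle part if
  \<open>g2 < g\<close>, and the middle and the right part otherwise.\<close>

definition K where "K = Y (- 2 * m - b) (- 2 * m - b + 1)"
definition N where "N = Y (- 2 * m - b + 2) (2 * m - 2 + b)"

lemma K_eq: "K = map ((+) (- w, - w)) (if g2 < g then rev (map flipx J) @ H else H @ J)"
proof -
  have [simp]: "place (- m) = (+) (- w, - w)"
    by (auto simp: place_def w_def par_def fun_eq_iff)
  have e: "- 2 * m = 2 * (- m)" and e1: "- 2 * m - 1 = 2 * (- m - 1) + 1" by simp_all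
  show ?thesis
  proof (cases "g2 < g")
    case True
    have "map flipx (rev J) = map (\<lambda>v. flipx ((p, - e) + flipy (flipx v))) J"
      by (simp add: rev_J)
    \<comment> \<open>Index \<open>- m - 1\<close> is outside the range of translates used by
      \<open>Rh\<close>, but its right part is the left part of translate
      \<open>- m\<close>.\<close>
    moreover have "(- w, - w) + flipx ((p, - e) + flipy (flipx v)) = place (- m - 1) v" for v
      by (auto simp: place_def flip_defs par_def w_def algebra_simps)
    moreover have "X (- 2 * m - 1) = map (place (- m - 1)) J"
      unfolding e1 X_odd by simp
    moreover have "X (- 2 * m) = map ((+) (- w, - w)) H"
      unfolding e X_even by simp
    ultimately show ?thesis using True Y_pair[of "- 2 * m - 1"] by (simp add: K_def b_def rev_map)
  next
    case False
    have "X (- 2 * m) = map ((+) (- w, - w)) H" "X (- 2 * m + 1) = map ((+) (- w, - w)) J"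
      unfolding e X_even X_odd by simp_all
    then show ?thesis using False Y_pair[of "- 2 * m"] by (simp add: K_def b_def)
  qed
qed

lemma rev_K: "rev K = map prod.swap K"
proof -
  define K0 where "K0 = (if g2 < g then rev (map flipx J) @ H else H @ J)"
  have "rev K0 = map prod.swap K0" using corner_l corner_r unfolding K0_def by (simp split: if_split)
  then have "rev (map ((+) (- w, - w)) K0) = map prod.swap (map ((+) (- w, - w)) K0)"
    by (simp add: rev_map prod.swap_def)
  then show ?thesis by (simp add: K_eq K0_def)
qed

text \<open>A quarter turn is a transposition followed by a mirror image. The transposition only
  reverses \<open>K\<close>, so the rotated corner again consists of strips.\<close>

lemma rot_K: "map rot K = Y (2 * m + b - 1) (2 * m + b)"
proof -
  have "map rot K = map flipx (map prod.swap K)" by (simp add: rot_def flipx_def)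
  also have "\<dots> = map flipx (rev K)" by (simp add: rev_K)
  also have "\<dots> = map (flipx \<circ> flipx) (Y (2 * m + b - 1) (2 * m + b))"
    unfolding K_def rev_Y by (simp add: algebra_simps)
  also have "flipx \<circ> flipx = id" by (auto simp: flipx_def fun_eq_iff)
  finally show ?thesis by simp
qed

lemma KN: "K @ N = Y (- 2 * m - b) (2 * m - 2 + b)"
  using Y_split[of "- 2 * m - b" "- 2 * m - b + 1" "2 * m - 2 + b"] m
  by (simp add: K_def N_def b_def)

lemma set_K: "set K = {v \<in> F C'. fst v < - d \<and> snd v < - d}"
proof -
  have flip_J: "set (rev (map flipx J)) = {v \<in> C'. fst v < - dd \<and> - g \<le> snd v \<and> snd v \<le> g2}"
  proof -
    have "v \<in> flipx ` set J \<longleftrightarrow> flipx v \<in> set J" for v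
      by (force simp: flipx_def image_iff)
    moreover have "flipx v \<in> C' \<longleftrightarrow> v \<in> C'" for v
      using C'_flipx[of v] C'_flipx[of "flipx v"] by (auto simp: flipx_def)
    ultimately show ?thesis by (auto simp: set_J) (auto simp: flipx_def)
  qed
  have "set (if g2 < g then rev (map flipx J) @ H else H @ J) =
      {(x, y) \<in> C'. - g \<le> x \<and> x \<le> g2 \<and> - g \<le> y \<and> y \<le> g2}"
  proof (cases "g2 < g")
    case True
    have "set (rev (map flipx J) @ H) = {(x, y) \<in> C'. - g \<le> x \<and> x \<le> g2 \<and> - g \<le> y \<and> y \<le> g2}"
      unfolding set_append flip_J set_H using C'_bd True g g2
      by (intro set_eqI, case_tac x) (force simp: hh_def dd_def)
    then show ?thesis using True by simp
  next
    case False
    have "set (H @ J) = {(x, y) \<in> C'. - g \<le> x \<and> x \<le> g2 \<and> - g \<le> y \<and> y \<le> g2}"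
      unfolding set_append set_H set_J using C'_bd False g g2
      by (intro set_eqI, case_tac x) (force simp: hh_def dd_def)
    then show ?thesis using False by simp
  qed
  then have "set K = (+) (- w, - w) ` {(x, y) \<in> C'. - g \<le> x \<and> x \<le> g2 \<and> - g \<le> y \<and> y \<le> g2}"
    by (simp add: K_eq)
  also have "\<dots> = {(x, y). (x + w, y + w) \<in> C' \<and> \<bar>x\<bar> \<le> h \<and> \<bar>y\<bar> \<le> h \<and> x < - d \<and> y < - d}"
  proof -
    have "(x, y) \<in> (+) (- w, - w) ` S \<longleftrightarrow> (x + w, y + w) \<in> S" for x y S
      by (force simp: image_iff)
    then show ?thesis using lins by (auto simp: prod_eq_iff)
  qed
  also have "\<dots> = {v \<in> F C'. fst v < - d \<and> snd v < - d}"
  proof -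
    have row: "(x, y) \<in> F C' \<longleftrightarrow> (x + w, y + w) \<in> C'" if "\<bar>x\<bar> \<le> h" "\<bar>y\<bar> \<le> h" "x < - d" "y < - d" for x y
    proof -
      have "\<bar>x - - m * p\<bar> \<le> hh" using that lins by (auto simp: w_def)
      then show ?thesis
        using F_mem_row[OF C'_closed that(1,2), of "- m" "-1"] that m by (auto simp: par_def w_def)
    qed
    show ?thesis
    proof (rule set_eqI)
      fix v show "v \<in> {(x, y). (x + w, y + w) \<in> C' \<and> \<bar>x\<bar> \<le> h \<and> \<bar>y\<bar> \<le> h \<and> x < - d \<and> y < - d} \<longleftrightarrow>
          v \<in> {v \<in> F C'. fst v < - d \<and> snd v < - d}"
        using row[of "fst v" "snd v"] F_bd[of "fst v" "snd v" C'] by (cases v) auto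
    qed
  qed
  finally show ?thesis .
qed

text \<open>The border at \<open>d = w - g2 - 1\<close> always separates two strips:
  \<open>d + 1\<close> is the left end of the middle part of translate \<open>m\<close> if
  \<open>g2 < g\<close>, and \<open>d\<close> is the right end of that of translate
  \<open>m - 1\<close> otherwise.\<close>

lemma idx_range:
  assumes "if even i then \<bar>x - i div 2 * p\<bar> \<le> dd else dd < x - i div 2 * p \<and> x - i div 2 * p \<le> hh"
  shows "\<bar>x\<bar> \<le> d \<longleftrightarrow> - 2 * m - b + 2 \<le> i \<and> i \<le> 2 * m - 2 + b"
proof -
  define l where "l = i div 2"
  define t where "t = l * p"
  have gd: "g2 < g \<and> dd = g2 \<and> hh = g \<and> b = 1 \<or> g \<le> g2 \<and> dd = g \<and> hh = g2 \<and> b = 0"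
    by (auto simp: dd_def hh_def b_def)
  have i: "i = 2 * l \<and> \<bar>x - t\<bar> \<le> dd \<or> i = 2 * l + 1 \<and> dd < x - t \<and> x - t \<le> hh"
    using assms unfolding l_def t_def by (cases "even i") auto
  have mult: "k * p \<le> l * p" if "k \<le> l" for k l using that p_pos by (intro mult_right_mono) auto
  consider "l \<le> - m - 1" | "l = - m" | "1 - m \<le> l" "l \<le> m - 2" | "l = m - 1" | "m \<le> l"
    using m by linarith
  then show ?thesis
  proof cases
    case 1
    then have "t \<le> - w - p" using mult[of l "- m - 1"] by (simp add: t_def w_def algebra_simps)
    then show ?thesis using i gd 1 w_ge g g2 m unfolding d_def p_def by auto
  next
    case 2
    then have "t = - w" by (simp add: t_def w_def)
    then show ?thesis using i gd 2 w_ge g g2 m unfolding d_def p_def by auto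
  next
    case 3
    then have "p - w \<le> t" "t \<le> w - 2 * p"
      using mult[of "1 - m" l] mult[of l "m - 2"] by (simp_all add: t_def w_def algebra_simps)
    then show ?thesis using i gd 3 w_ge g g2 m unfolding d_def p_def by auto
  next
    case 4
    then have "t = w - p" by (simp add: t_def w_def left_diff_distrib)
    then show ?thesis using i gd 4 w_ge g g2 m unfolding d_def p_def by auto
  next
    case 5
    then have "w \<le> t" using mult[of m l] by (simp add: t_def w_def)
    then show ?thesis using i gd 5 w_ge g g2 m unfolding d_def p_def by auto
  qed
qed

lemma idx_position:
  "if even (idx x) then \<bar>x - idx x div 2 * p\<bar> \<le> dd
   else dd < x - idx x div 2 * p \<and> x - idx x div 2 * p \<le> hh"
proof -
  define l where "l = (x + dd) div p"
  define t where "t = l * p"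
  have "x + dd - t = (x + dd) mod p" by (simp add: t_def l_def minus_div_mult_eq_mod)
  then have "0 \<le> x + dd - t" "x + dd - t < p" using p_pos by auto
  then have "- dd \<le> x - t" "x - t \<le> hh" using p_eq by auto
  then show ?thesis
    by (cases "dd < x - t") (simp_all add: idx_def Let_def flip: l_def t_def)
qed

lemma set_N: "set N = {v \<in> F C'. \<bar>fst v\<bar> \<le> d \<and> snd v < - d}"
proof -
  have "(x, y) \<in> set N \<longleftrightarrow> (x, y) \<in> F C' \<and> \<bar>x\<bar> \<le> d \<and> y < - d" for x y
  proof -
    define i where "i = idx x"
    define l where "l = i div 2"
    define in_range where "in_range \<longleftrightarrow> - 2 * m - b + 2 \<le> i \<and> i \<le> 2 * m - 2 + b"
    note pos = idx_position[of x, folded i_def]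
    have range: "in_range \<longleftrightarrow> \<bar>x\<bar> \<le> d" unfolding in_range_def using idx_range[OF pos] by simp
    have "(x, y) \<in> set N \<longleftrightarrow> in_range \<and> (x, y) \<in> set (X i)"
    proof -
      have "(x, y) \<in> set N \<longleftrightarrow> (\<exists>j\<in>{- 2 * m - b + 2..2 * m - 2 + b}. (x, y) \<in> set (X j))"
        by (simp add: N_def Y_def)
      moreover have "j = i" if "(x, y) \<in> set (X j)" for j
        using idx_X[OF that] by (simp add: i_def)
      ultimately show ?thesis unfolding in_range_def by (metis atLeastAtMost_iff)
    qed
    also have "\<dots> \<longleftrightarrow> in_range \<and> (x - l * p, y + (w + par l)) \<in> C' \<and> - h \<le> y \<and> y < - d"
      unfolding mem_X l_def[symmetric] using pos unfolding l_def[symmetric] by auto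
    also have "\<dots> \<longleftrightarrow> \<bar>x\<bar> \<le> d \<and> (x, y) \<in> F C' \<and> y < - d"
    proof -
      have "(x, y) \<in> F C' \<longleftrightarrow> (x - l * p, y + (w + par l)) \<in> C'" if "in_range" "- h \<le> y" "y < - d"
      proof -
        have "\<bar>x\<bar> \<le> h" "\<bar>y\<bar> \<le> h" "d < -1 * y" using that range d_less d_ge by auto
        moreover have "\<bar>l\<bar> \<le> m"
        proof -
          have "2 * l \<le> i" "i \<le> 2 * l + 1" by (simp_all add: l_def)
          moreover have "b = 0 \<or> b = 1" by (simp add: b_def)
          ultimately show ?thesis using that(1) unfolding in_range_def by linarith
        qed
        moreover have "\<bar>x - l * p\<bar> \<le> hh"
          using pos unfolding l_def[symmetric] using g g2 by (cases "even i") (auto simp: hh_def dd_def)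
        moreover have "y - (- 1) * (w + par l) = y + (w + par l)" by simp
        ultimately show ?thesis using F_mem_row[OF C'_closed, of x y l "-1"] by metis
      qed
      moreover have "- h \<le> y" if "(x, y) \<in> F C'" using F_bd[OF that] by arith
      ultimately show ?thesis using range by blast
    qed
    finally show ?thesis by blast
  qed
  then show ?thesis by auto
qed

theorem quarter_F: "quarter h d r s (F C') K N"
proof
  show "0 \<le> d" by (rule d_ge)
  show "prod.swap v \<in> F C'" if "v \<in> F C'" for v
  proof -
    have "prod.swap ` C' \<subseteq> C'" using C'_swap by auto
    then have "F (prod.swap ` C') \<subseteq> F C'" by (auto simp: F_def)
    then show ?thesis using swap_F[of C'] that by blast
  qed
  show "flipx v \<in> F C'" if "v \<in> F C'" for v
    using F_flip[of C' "fst v" "snd v"] C'_flipx C'_flipy that by (simp add: flip_defs) force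
  show "F C' \<subseteq> bd h" "F C' \<inter> bd d = {}" using F_subset[of C'] by auto
  show "set K = {v \<in> F C'. fst v < - d \<and> snd v < - d}" by (rule set_K)
  show "set N = {v \<in> F C'. \<bar>fst v\<bar> \<le> d \<and> snd v < - d}" by (rule set_N)
  show "K \<noteq> []" using H_ne by (auto simp: K_eq)
  show "N \<noteq> []"
  proof -
    have "X 0 \<noteq> []" using H_ne X_even[of 0] by simp
    moreover have "0 \<in> set [- 2 * m - b + 2..2 * m - 2 + b]" using m by (auto simp: b_def)
    ultimately show ?thesis by (auto simp: N_def Y_def)
  qed
  show "distinct K" "distinct N" by (simp_all add: K_def N_def distinct_Y)
  show "rev K = map prod.swap K" by (rule rev_K)
  show "rev N = map flipx N" unfolding N_def rev_Y by (simp add: algebra_simps)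
  show "rev (K @ N) = map (\<lambda>v. (- (h - d), - (h + d + 1)) - v) (K @ N)"
  proof -
    \<comment> \<open>Reversal mirrors the path and negates its index range, which amounts to moving
      the range by two. So the glide reflection of \<open>Y_add_2\<close> followed by the mirror
      image is the required point reflection.\<close>
    have "- (2 * m - 2 + b) = (- 2 * m - b) + 2" "- (- 2 * m - b) = (2 * m - 2 + b) + 2" by simp_all
    then have "rev (K @ N) = map flipx (map (\<lambda>v. (p + fst v, - (2 * w + e) - snd v)) (K @ N))"
      unfolding KN rev_Y Y_add_2[symmetric] by metis
    moreover have "h - d = p" "h + d + 1 = 2 * w + e" by (auto simp: lins)
    ultimately show ?thesis by (simp add: flipx_def minus_prod_def)
  qed
  show "successively (adj r s) (K @ N @ map rot K)"
  proof -
    have "K @ N @ map rot K = Y (- 2 * m - b) (2 * m + b)"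
      using Y_split[of "- 2 * m - b" "2 * m - 2 + b" "2 * m + b"] KN m
      unfolding rot_K append_assoc[symmetric] by (simp add: b_def algebra_simps)
    \<comment> \<open>\<open>path_Y\<close> provides paths with even end indices, so the range is
      embedded in a longer one.\<close>
    moreover have "Y (2 * (- m - 1)) (2 * (m + 1)) =
        Y (2 * (- m - 1)) (- 2 * m - b - 1) @ Y (- 2 * m - b) (2 * m + b) @ Y (2 * m + b + 1) (2 * (m + 1))"
      using Y_split[of "2 * (- m - 1)" "- 2 * m - b - 1" "2 * (m + 1)"]
        Y_split[of "- 2 * m - b" "2 * m + b" "2 * (m + 1)"] m by (simp add: b_def)
    moreover have "successively (adj r s) (Y (2 * (- m - 1)) (2 * (m + 1)))"
      by (rule path_Y) (use m in simp)
    ultimately show ?thesis by (simp add: successively_append_iff)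
  qed
qed

end

section \<open>Creating a tour and passing it through one step\<close>

lemma flipx_flipx: "flipx (flipx v) = v"
  by (simp add: flipx_def)

context lift
begin

text \<open>The arc is a single square, and the step \<open>(p, - e)\<close> to the next translate
  is itself a move of the smaller leaper.\<close>

lemma band_single: "closed_in hh dd {(0, 0)} \<Longrightarrow> band g g2 m {(0, 0)} [(0, 0)] [] \<bar>e\<bar> p"
  using g g2 p_pos
  by unfold_locales (auto simp: flip_defs e_def hh_def dd_def adj_def)

lemma quarter_single:
  assumes "closed_in hh dd {(0, 0)}"
  shows "\<exists>K N. quarter h d (hh - dd) (hh + dd + 1) (F {(0, 0)}) K N"
proof -
  have "hh - dd = \<bar>e\<bar>" "hh + dd + 1 = p" by (auto simp: lins)
  then show ?thesis using band.quarter_F[OF band_single[OF assms]] by metis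
qed

text \<open>The arc consists of the lower side \<open>N\<close>, followed by the lower right corner
  and the right side, that is, \<open>K @ N\<close> after a quarter turn. Unless
  \<open>g2 < g\<close>, its upper mirror image is used.\<close>

lemma quarter_lift:
  assumes "quarter hh dd r s C K N" and cl: "closed_in hh dd C"
  shows "\<exists>K N. quarter h d r s (F C) K N"
proof -
  interpret Q: quarter hh dd r s C K N by (rule assms)
  have "\<exists>v \<in> set K. True" using Q.K_ne by (cases K) auto
  then obtain v where "v \<in> C" "fst v < - dd" by (auto simp: Q.set_K)
  moreover have "v \<in> bd hh" using \<open>v \<in> C\<close> Q.C_sub(1) by blast
  ultimately have "dd < hh" by (cases v) auto
  then have ne: "g \<noteq> g2" by (auto simp: hh_def dd_def)
  define J where "J = map rot (K @ N)"
  have split: "successively (adj r s) (K @ N @ map rot K)" "successively (adj r s) (N @ map rot K)"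
      "successively (adj r s) (K @ N)"
    using Q.path Q.N_ne by (auto simp: successively_append_iff)
  have rotate: "successively (adj r s) (map rot xs) \<longleftrightarrow> successively (adj r s) xs" for xs
    by (rule successively_map_iff) simp
  have NJ: "successively (adj r s) (N @ J)"
    using successively_overlap[of "adj r s" N "map rot K" "map rot N"] split rotate[of "K @ N"] Q.K_ne
    by (simp add: J_def)
  have pe: "p = hh + dd + 1" "\<bar>e\<bar> = hh - dd" by (auto simp: lins)
  \<comment> \<open>The quarter turn takes the vector \<open>(- (hh - dd), - (hh + dd + 1))\<close>
    of \<open>rev_KN\<close> to \<open>(p, - (hh - dd))\<close>.\<close>
  have rev_J: "rev J = map (\<lambda>v. (p, - (hh - dd)) + flipy (flipx v)) J"
    unfolding J_def rev_map Q.rev_KN by (auto simp: flip_defs pe)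
  have flip_J: "rev (map flipx J) = map (rot \<circ> rot \<circ> rot) N @ K"
  proof -
    have "map flipx (map rot K) = rev K" unfolding Q.rev_K by (simp add: flip_defs prod.swap_def)
    moreover have "map flipx (map rot N) = rev (map (rot \<circ> rot \<circ> rot) N)"
      unfolding rev_map Q.rev_N by (simp add: flip_defs)
    ultimately show ?thesis by (simp add: J_def)
  qed
  \<comment> \<open>Left side, lower left corner and lower side form a stretch of the tour. Its
    image in the next translate is \<open>J\<close> followed by the next middle part.\<close>
  have link: "successively (adj r s) (N @ J @ map (\<lambda>v. (p, - (hh - dd)) + flipy v) N)"
  proof -
    let ?f = "\<lambda>v. (p, - (hh - dd)) + flipy v"
    have "J = rev (rev J)" by simp
    also have "\<dots> = map ?f (rev (map flipx J))" unfolding rev_J by (simp add: rev_map)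
    finally have J: "J = map ?f (map (rot \<circ> rot \<circ> rot) N @ K)" unfolding flip_J .
    have "successively (adj r s) (map (rot \<circ> rot \<circ> rot) (N @ map rot K))"
      unfolding successively_map_iff[of "adj r s" "rot \<circ> rot \<circ> rot", simplified] using split(2) .
    moreover have "map (rot \<circ> rot \<circ> rot) (N @ map rot K) = map (rot \<circ> rot \<circ> rot) N @ K"
      by (simp add: rot_def comp_def)
    ultimately have "successively (adj r s) ((map (rot \<circ> rot \<circ> rot) N @ K) @ N)"
      using successively_overlap[of "adj r s" _ K N] split(3) Q.K_ne by simp
    then have "successively (adj r s) (map ?f ((map (rot \<circ> rot \<circ> rot) N @ K) @ N))"
      by (subst successively_map_iff) simp_all
    then have "successively (adj r s) (J @ map ?f N)" using J by simp
    moreover have "J \<noteq> []" using Q.K_ne by (simp add: J_def)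
    ultimately show ?thesis using NJ successively_overlap by blast
  qed
  have set_J: "set J = {v \<in> C. dd < fst v \<and> snd v \<le> dd}"
  proof -
    have "v \<in> set J \<longleftrightarrow> rot (rot (rot v)) \<in> set (K @ N)" for v
    proof -
      have "rot (rot (rot (rot u))) = u" for u by (simp add: rot_def)
      then have "v \<in> rot ` S \<longleftrightarrow> rot (rot (rot v)) \<in> S" for S by (metis imageE imageI)
      then show ?thesis unfolding J_def set_map .
    qed
    moreover have "rot (rot (rot v)) \<in> C \<longleftrightarrow> v \<in> C" for v
      using Q.C_rot[of v] Q.C_rot[of "rot v"] Q.C_rot[of "rot (rot v)"] Q.C_rot[of "rot (rot (rot v))"]
      by (auto simp: rot_def)
    ultimately show ?thesis using Q.d by (auto simp: Q.set_K Q.set_N) (auto simp: rot_def)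
  qed
  have dist_J: "distinct J"
    using Q.distinct Q.d by (auto simp: J_def distinct_map Q.set_K Q.set_N inj_on_def rot_def prod_eq_iff)
  have C_bd: "\<bar>fst v\<bar> \<le> hh \<and> \<bar>snd v\<bar> \<le> hh \<and> (dd < \<bar>fst v\<bar> \<or> dd < \<bar>snd v\<bar>)" if "v \<in> C" for v
    using that Q.C_sub by (cases v) auto
  have swap3: "prod.swap (rot (rot (rot v))) = flipx v" "rot (rot (rot (flipx v))) = prod.swap v" for v
    by (simp_all add: flip_defs prod.swap_def)
  have corner: "rev ((map (rot \<circ> rot \<circ> rot) N @ K) @ N) = map prod.swap ((map (rot \<circ> rot \<circ> rot) N @ K) @ N)"
    by (simp add: Q.rev_K Q.rev_N rev_map swap3)
  have "band g g2 m C (if g2 < g then N else map flipy N) (if g2 < g then J else map flipy J) r s"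
  proof (cases "g2 < g")
    case True
    then have e: "e = hh - dd" and gd: "hh = g" "dd = g2" by (auto simp: lins)
    have "band g g2 m C N J r s"
    proof
      show "closed_in hh dd C" by (rule cl)
      show "set N = {v \<in> C. \<bar>fst v\<bar> \<le> dd \<and> - g \<le> snd v \<and> snd v \<le> g2}"
        using C_bd gd by (force simp: Q.set_N)
      show "set J = {v \<in> C. dd < fst v \<and> - g \<le> snd v \<and> snd v \<le> g2}"
        using C_bd gd by (force simp: set_J)
      show "rev (rev (map flipx J) @ N) = map prod.swap (rev (map flipx J) @ N)"
        unfolding flip_J by (rule corner)
      show "rev J = map (\<lambda>v. (p, - e) + flipy (flipx v)) J" unfolding e by (rule rev_J)
      show "successively (adj r s) (N @ J @ map (\<lambda>v. (p, - e) + flipy v) N)" unfolding e by (rule link)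
    qed (use Q.C_swap Q.C_flipx Q.N_ne Q.distinct dist_J Q.rev_N True in auto)
    then show ?thesis using True by simp
  next
    case False
    then have e: "e = - (hh - dd)" and gd: "hh = g2" "dd = g" by (auto simp: lins)
    have flipy_mem: "v \<in> flipy ` S \<longleftrightarrow> flipy v \<in> S" for v S
      by (metis flipy_flipy imageE imageI)
    have C_flipy: "flipy v \<in> C \<longleftrightarrow> v \<in> C" for v
      using Q.C_flipy flipy_flipy by metis
    have "band g g2 m C (map flipy N) (map flipy J) r s"
    proof
      show "closed_in hh dd C" by (rule cl)
      show "set (map flipy N) = {v \<in> C. \<bar>fst v\<bar> \<le> dd \<and> - g \<le> snd v \<and> snd v \<le> g2}"
        using C_bd gd by (auto simp: Q.set_N flipy_mem C_flipy) (force simp: flipy_def)+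
      show "set (map flipy J) = {v \<in> C. dd < fst v \<and> - g \<le> snd v \<and> snd v \<le> g2}"
        using C_bd gd by (auto simp: set_J flipy_mem C_flipy) (force simp: flipy_def)+
      have inj: "inj flipy" by (metis flipy_flipy injI)
      show "distinct (map flipy N)" "distinct (map flipy J)"
        using inj dist_J Q.distinct by (auto simp: distinct_map intro: inj_on_subset)
      show "rev (map flipy N) = map flipx (map flipy N)"
        by (simp add: rev_map Q.rev_N flip_defs)
      show "rev (map flipy J) = map (\<lambda>v. (p, - e) + flipy (flipx v)) (map flipy J)"
        unfolding rev_map rev_J e by (auto simp: flip_defs)
      have "map flipy (N @ J @ map (\<lambda>v. (p, - (hh - dd)) + flipy v) N) =
          map flipy N @ map flipy J @ map (\<lambda>v. (p, - e) + flipy v) (map flipy N)"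
        unfolding e by (auto simp: flip_defs)
      then show "successively (adj r s) (map flipy N @ map flipy J @ map (\<lambda>v. (p, - e) + flipy v) (map flipy N))"
        using link successively_map_iff[of "adj r s" flipy] by (metis adj_flipy)
      \<comment> \<open>A half turn, which commutes with transposition, takes the reversed lower
        left arc to the upper right one, so the latter inherits the diagonal symmetry.\<close>
      have "map (flipy \<circ> flipx) (rev ((map (rot \<circ> rot \<circ> rot) N @ K) @ N)) =
          map flipy (map flipx (rev N) @ J)"
        unfolding flip_J[symmetric] by (simp add: rev_map comp_def flipx_flipx)
      then have eq: "map flipy N @ map flipy J = map (flipy \<circ> flipx) (rev ((map (rot \<circ> rot \<circ> rot) N @ K) @ N))"
        by (simp add: Q.rev_N comp_def flipx_flipx)
      show "rev (map flipy N @ map flipy J) = map prod.swap (map flipy N @ map flipy J)"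
      proof -
        define W where "W = (map (rot \<circ> rot \<circ> rot) N @ K) @ N"
        have "map prod.swap (map (flipy \<circ> flipx) (rev W)) = map (flipy \<circ> flipx) W"
          unfolding W_def corner unfolding W_def[symmetric] by (simp add: flip_defs prod.swap_def)
        then show ?thesis unfolding eq W_def[symmetric] rev_map by simp
      qed
    qed (use Q.C_swap Q.C_flipx Q.N_ne False in auto)
    then show ?thesis using False by simp
  qed
  from band.quarter_F[OF this] show ?thesis by blast
qed

end

section \<open>Induction along the continued fraction\<close>

text \<open>A tower records the half-widths \<open>h i\<close> of the boards and \<open>d i\<close> of their central squares of
  isolated vertices along the continued fraction: \<open>p\<^sub>i = h i - d i\<close> and \<open>q\<^sub>i = h i + d i + 1\<close>.\<close>

definition tower :: "nat \<Rightarrow> (nat \<Rightarrow> int) \<Rightarrow> (nat \<Rightarrow> int) \<Rightarrow> bool" where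
  "tower k h d \<longleftrightarrow> h k = 0 \<and> d k = 0 \<and> (\<forall>i<k. \<exists>g g2 m. lift g g2 m \<and>
     h i = lift.h g g2 m \<and> d i = lift.d g g2 m \<and> h (Suc i) = lift.hh g g2 \<and> d (Suc i) = lift.dd g g2)"

text \<open>Isolated vertices count as type \<open>0\<close>, so that one lift turns type
  \<open>i\<close> into type \<open>i + 1\<close> throughout. \<open>C i\<close> is a centred
  representative, shifted by the \<open>(2 * d i + 1)\<^sup>2\<close> elements of
  \<open>bd (d i)\<close>.\<close>

definition decomposed :: "nat \<Rightarrow> (nat \<Rightarrow> int) \<Rightarrow> (nat \<Rightarrow> int) \<Rightarrow> (nat \<Rightarrow> square set) \<Rightarrow> bool" where
  "decomposed k h d C \<longleftrightarrow> C 0 = {(0, 0)} \<and>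
     (\<forall>i\<le>k. \<forall>t\<in>bd (d i). closed_in (h 0) (d 0) ((+) t ` C i) \<and>
        connected_on (ladj (h 0) (d 0)) ((+) t ` C i) \<and>
        (\<forall>v\<in>C i. same_region (h 0) (d 0) (fst v) (fst (t + v)) \<and> same_region (h 0) (d 0) (snd v) (snd (t + v)))) \<and>
     (\<forall>a\<in>bd (h 0). \<exists>i\<le>k. \<exists>t\<in>bd (d i). a \<in> (+) t ` C i) \<and>
     (\<forall>i\<le>k. \<forall>j\<le>k. \<forall>t\<in>bd (d i). \<forall>t'\<in>bd (d j). (+) t ` C i \<inter> (+) t' ` C j \<noteq> {} \<longrightarrow> i = j \<and> t = t') \<and>
     (\<forall>i\<in>{1..k}. \<exists>K N. quarter (h 0) (d 0) (h i - d i) (h i + d i + 1) (C i) K N)"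

lemma bd_inner_isolated:
  assumes "0 \<le> d" "d < h" "a \<in> bd d" "b \<in> bd h"
  shows "\<not> ladj h d a b"
  using assms by (cases a; cases b) (auto simp: adj_def)

lemma card_bd: "0 \<le> d \<Longrightarrow> int (card (bd d)) = (2 * d + 1)\<^sup>2"
  by (simp add: bd_def card_cartesian_product power2_eq_square)

lemma tower_nonneg: "tower k h d \<Longrightarrow> i \<le> k \<Longrightarrow> 0 \<le> d i"
  unfolding tower_def by (metis lift.d_ge nless_le order_refl)

lemma decomposedD:
  assumes "decomposed k h d C"
  shows decomposed_0: "C 0 = {(0, 0)}"
    and decomposed_closed: "i \<le> k \<Longrightarrow> t \<in> bd (d i) \<Longrightarrow> closed_in (h 0) (d 0) ((+) t ` C i)"
    and decomposed_connected: "i \<le> k \<Longrightarrow> t \<in> bd (d i) \<Longrightarrow> connected_on (ladj (h 0) (d 0)) ((+) t ` C i)"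
    and decomposed_region: "i \<le> k \<Longrightarrow> t \<in> bd (d i) \<Longrightarrow> v \<in> C i \<Longrightarrow>
      same_region (h 0) (d 0) (fst v) (fst (t + v)) \<and> same_region (h 0) (d 0) (snd v) (snd (t + v))"
    and decomposed_cover: "a \<in> bd (h 0) \<Longrightarrow> \<exists>i\<le>k. \<exists>t\<in>bd (d i). a \<in> (+) t ` C i"
    and decomposed_disjoint: "i \<le> k \<Longrightarrow> j \<le> k \<Longrightarrow> t \<in> bd (d i) \<Longrightarrow> t' \<in> bd (d j) \<Longrightarrow>
      (+) t ` C i \<inter> (+) t' ` C j \<noteq> {} \<Longrightarrow> i = j \<and> t = t'"
    and decomposed_quarter: "i \<in> {1..k} \<Longrightarrow> \<exists>K N. quarter (h 0) (d 0) (h i - d i) (h i + d i + 1) (C i) K N"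
proof -
  note parts = assms[unfolded decomposed_def, THEN conjunct1] assms[unfolded decomposed_def, THEN conjunct2]
  show "C 0 = {(0, 0)}" by (rule parts(1))
  show "i \<le> k \<Longrightarrow> t \<in> bd (d i) \<Longrightarrow> closed_in (h 0) (d 0) ((+) t ` C i)"
    "i \<le> k \<Longrightarrow> t \<in> bd (d i) \<Longrightarrow> connected_on (ladj (h 0) (d 0)) ((+) t ` C i)"
    "i \<le> k \<Longrightarrow> t \<in> bd (d i) \<Longrightarrow> v \<in> C i \<Longrightarrow>
      same_region (h 0) (d 0) (fst v) (fst (t + v)) \<and> same_region (h 0) (d 0) (snd v) (snd (t + v))"
    using parts(2)[THEN conjunct1] by (simp_all only: Ball_def)
  show "a \<in> bd (h 0) \<Longrightarrow> \<exists>i\<le>k. \<exists>t\<in>bd (d i). a \<in> (+) t ` C i"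
    using parts(2)[THEN conjunct2, THEN conjunct1] by (rule bspec)
  show "i \<le> k \<Longrightarrow> j \<le> k \<Longrightarrow> t \<in> bd (d i) \<Longrightarrow> t' \<in> bd (d j) \<Longrightarrow>
      (+) t ` C i \<inter> (+) t' ` C j \<noteq> {} \<Longrightarrow> i = j \<and> t = t'"
    using parts(2)[THEN conjunct2, THEN conjunct2, THEN conjunct1, rule_format, of i j t t'] by blast
  show "i \<in> {1..k} \<Longrightarrow> \<exists>K N. quarter (h 0) (d 0) (h i - d i) (h i + d i + 1) (C i) K N"
    using parts(2)[THEN conjunct2, THEN conjunct2, THEN conjunct2] by (rule bspec)
qed

text \<open>The induction peels off the first term of the fraction: the shifted sequences describe
  the smaller board, whence the arbitrary \<open>hs\<close> and \<open>ds\<close>.\<close>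

lemma tower_decomposed:
  assumes "tower k hs ds"
  shows "\<exists>C. decomposed k hs ds C"
  using assms
proof (induction k arbitrary: hs ds)
  case 0
  then have hd: "hs 0 = 0" "ds 0 = 0" by (auto simp: tower_def)
  have bd0: "bd 0 = {(0, 0)}" by (auto simp: bd_def)
  have "decomposed 0 hs ds (\<lambda>_. {(0, 0)})"
    unfolding decomposed_def
    by (simp add: hd bd0 closed_in_def connected_on_def same_region_def zero_prod_def)
  then show ?case by blast
next
  case (Suc k)
  obtain g g2 m where "lift g g2 m" and h0: "hs 0 = lift.h g g2 m" "ds 0 = lift.d g g2 m"
      "hs (Suc 0) = lift.hh g g2" "ds (Suc 0) = lift.dd g g2"
    using Suc.prems unfolding tower_def by blast
  then interpret lift g g2 m by simp
  have "tower k (hs \<circ> Suc) (ds \<circ> Suc)" using Suc.prems unfolding tower_def by auto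
  then obtain C' where dec: "decomposed k (hs \<circ> Suc) (ds \<circ> Suc) C'" using Suc.IH by blast
  note C'0 = decomposed_0[OF dec]
  note C' = decomposed_closed[OF dec, unfolded comp_def h0] decomposed_connected[OF dec, unfolded comp_def h0]
    decomposed_region[OF dec, unfolded comp_def h0]
  note cover = decomposed_cover[OF dec, unfolded comp_def h0]
  note disj = decomposed_disjoint[OF dec, unfolded comp_def]
  note quart = decomposed_quarter[OF dec, unfolded comp_def h0]
  have closed0: "closed_in hh dd (C' i)" if "i \<le> k" for i
  proof -
    have "(0, 0) \<in> bd (ds (Suc i))" using tower_nonneg[OF Suc.prems, of "Suc i"] that by simp
    from C'(1)[OF that this] show ?thesis by (simp flip: zero_prod_def)
  qed
  define C where "C i = (case i of 0 \<Rightarrow> {(0, 0)} | Suc j \<Rightarrow> F (C' j))" for i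
  have C0: "C 0 = {(0, 0)}" and CS: "C (Suc j) = F (C' j)" for j by (simp_all add: C_def)
  have CSt: "(+) t ` C (Suc j) = F ((+) t ` C' j)" if "j \<le> k" "t \<in> bd (ds (Suc j))" for j t
    unfolding CS using F_translate(1)[of "C' j" t] C'(3)[OF that] by simp
  have C0t: "(+) t ` C 0 = {t}" for t by (simp add: C0 flip: zero_prod_def)
  have F_outer: "a \<notin> bd (ds 0)" "a \<in> bd (hs 0)" if "a \<in> F U" for a U
    using that F_subset h0 by auto
  have "closed_in (hs 0) (ds 0) ((+) t ` C i) \<and> connected_on (ladj (hs 0) (ds 0)) ((+) t ` C i) \<and>
      (\<forall>v\<in>C i. same_region (hs 0) (ds 0) (fst v) (fst (t + v)) \<and> same_region (hs 0) (ds 0) (snd v) (snd (t + v)))"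
    if it: "i \<le> Suc k" "t \<in> bd (ds i)" for i t
  proof (cases i)
    case 0
    have "t \<in> bd d" using it 0 h0 by simp
    moreover have "bd d \<subseteq> bd h" using d_less by (auto simp: bd_def)
    ultimately have "closed_in h d {t}" "t \<in> bd d"
      using bd_inner_isolated[OF d_ge d_less] unfolding closed_in_def by blast+
    then show ?thesis using d_less unfolding 0 C0t h0
      by (cases t) (auto simp: C0 connected_on_def same_region_def)
  next
    case (Suc j)
    then have j: "j \<le> k" "t \<in> bd (ds (Suc j))" using it by auto
    have "(+) t ` C' j \<subseteq> bd hh" using C'(1)[OF j] by (simp add: closed_in_def)
    then show ?thesis
      unfolding Suc CSt[OF j] h0 using F_closed C'(1)[OF j] F_connected C'(2)[OF j]
        F_translate(2)[of "C' j" t] C'(3)[OF j] unfolding CS by blast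
  qed
  moreover have "\<exists>i\<le>Suc k. \<exists>t\<in>bd (ds i). a \<in> (+) t ` C i" if "a \<in> bd (hs 0)" for a
  proof (cases "a \<in> bd (ds 0)")
    case True
    then show ?thesis using C0t by blast
  next
    case False
    then obtain u where u: "u \<in> bd hh" "R a u"
      using outer_related[of a] \<open>a \<in> bd (hs 0)\<close> h0 by auto
    then obtain j t where j: "j \<le> k" "t \<in> bd (ds (Suc j))" "u \<in> (+) t ` C' j" using cover by blast
    then have "a \<in> (+) t ` C (Suc j)" using u CSt by (auto simp: F_def)
    then show ?thesis using j by (meson Suc_le_mono)
  qed
  moreover have "i = j \<and> t = t'"
    if ij: "i \<le> Suc k" "j \<le> Suc k" "t \<in> bd (ds i)" "t' \<in> bd (ds j)" "(+) t ` C i \<inter> (+) t' ` C j \<noteq> {}" for i j t t'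
  proof -
    obtain a where a: "a \<in> (+) t ` C i" "a \<in> (+) t' ` C j" using ij by blast
    show ?thesis
    proof (cases i; cases j)
      assume "i = 0" "j = 0"
      then show ?thesis using a by (simp add: C0t)
    next
      fix j' assume "i = 0" "j = Suc j'"
      then show ?thesis using a ij F_outer CSt[of j' t'] by (auto simp: C0t)
    next
      fix i' assume "i = Suc i'" "j = 0"
      then show ?thesis using a ij F_outer CSt[of i' t] by (auto simp: C0t)
    next
      fix i' j' assume s: "i = Suc i'" "j = Suc j'"
      then have "a \<in> F ((+) t ` C' i')" "a \<in> F ((+) t' ` C' j')" using a ij CSt by auto
      then obtain u v where "u \<in> (+) t ` C' i'" "R a u" "v \<in> (+) t' ` C' j'" "R a v"
        unfolding F_def by blast
      \<comment> \<open>A common square of two lifted sets yields a common square of the sets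
        below.\<close>
      then have "v \<in> (+) t ` C' i' \<inter> (+) t' ` C' j'"
        using related_closed[OF C'(1)[of i' t], of a u v] ij s by simp
      then show ?thesis using disj[of i' j' t t'] ij s by auto
    qed
  qed
  moreover have "\<exists>K N. quarter (hs 0) (ds 0) (hs i - ds i) (hs i + ds i + 1) (C i) K N" if "i \<in> {1..Suc k}" for i
  proof -
    obtain j where j: "i = Suc j" "j \<le> k" using \<open>i \<in> {1..Suc k}\<close> by (cases i) auto
    \<comment> \<open>Type \<open>1\<close> comes from the isolated vertices of the smaller board
      and acquires its tour here; the tours of higher types are inherited through
      \<open>quarter_lift\<close>.\<close>
    show ?thesis
    proof (cases "j = 0")
      case True
      then show ?thesis using quarter_single closed0[of 0] C'0 j by (simp add: CS h0)
    next
      case False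
      then obtain K N where "quarter hh dd (hs i - ds i) (hs i + ds i + 1) (C' j) K N"
        using quart[of j] j by auto
      then show ?thesis using quarter_lift closed0[of j] j by (simp add: CS h0)
    qed
  qed
  ultimately have "decomposed (Suc k) hs ds C" unfolding decomposed_def using C0 by blast
  then show ?case by blast
qed

section \<open>Translates of cycles and transport to the chessboard\<close>

lemma translate_graph_of:
  "translate t (graph_of (adj r s) S) = graph_of (adj r s) ((+) t ` S)"
proof -
  have "{{a, b} |a b. a \<in> (+) t ` S \<and> b \<in> (+) t ` S \<and> adj r s a b} =
      {{t + a, t + b} |a b. a \<in> S \<and> b \<in> S \<and> adj r s a b}"
  proof (intro set_eqI iffI)
    fix e assume "e \<in> {{t + a, t + b} |a b. a \<in> S \<and> b \<in> S \<and> adj r s a b}"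
    then obtain a b where "e = {t + a, t + b}" "a \<in> S" "b \<in> S" "adj r s a b" by blast
    then show "e \<in> {{a, b} |a b. a \<in> (+) t ` S \<and> b \<in> (+) t ` S \<and> adj r s a b}"
      by (intro CollectI exI[of _ "t + a"] exI[of _ "t + b"]) simp
  next
    fix e assume "e \<in> {{a, b} |a b. a \<in> (+) t ` S \<and> b \<in> (+) t ` S \<and> adj r s a b}"
    then obtain a b where "e = {t + a, t + b}" "a \<in> S" "b \<in> S" "adj r s (t + a) (t + b)" by blast
    then show "e \<in> {{t + a, t + b} |a b. a \<in> S \<and> b \<in> S \<and> adj r s a b}"
      unfolding adj_translate by blast
  qed
  also have "\<dots> = (\<lambda>e. (+) t ` e) ` {{a, b} |a b. a \<in> S \<and> b \<in> S \<and> adj r s a b}"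
    by (auto simp: image_iff) (metis image_empty image_insert)+
  finally show ?thesis by (simp add: translate_def graph_of_def)
qed

lemma is_cycle_translate: "is_cycle C \<Longrightarrow> is_cycle (translate t C)"
proof -
  assume "is_cycle C"
  then obtain vs where vs: "distinct vs" "length vs \<ge> 3" "verts C = set vs"
      "edges C = {{vs ! i, vs ! (Suc i mod length vs)} | i. i < length vs}"
    unfolding is_cycle_def by blast
  have nth: "map ((+) t) vs ! (Suc i mod length vs) = t + vs ! (Suc i mod length vs)" for i
    using vs(2) by (intro nth_map mod_less_divisor) linarith
  have "edges C = (\<lambda>i. {vs ! i, vs ! (Suc i mod length vs)}) ` {..<length vs}"
    unfolding vs(4) by auto
  then have "(\<lambda>e. (+) t ` e) ` edges C = (\<lambda>i. (+) t ` {vs ! i, vs ! (Suc i mod length vs)}) ` {..<length vs}"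
    by (simp only: image_image)
  also have "\<dots> = (\<lambda>i. {map ((+) t) vs ! i, map ((+) t) vs ! (Suc i mod length vs)}) ` {..<length vs}"
    using nth by (intro image_cong) auto
  also have "\<dots> = {{map ((+) t) vs ! i, map ((+) t) vs ! (Suc i mod length vs)} | i. i < length vs}"
    unfolding lessThan_def by blast
  finally show ?thesis
    unfolding is_cycle_def translate_def
    by (intro exI[of _ "map ((+) t) vs"]) (use vs in \<open>auto simp: distinct_map\<close>)
qed

lemma has_hamiltonian_cycle_translate:
  assumes "has_hamiltonian_cycle G"
  shows "has_hamiltonian_cycle (translate t G)"
proof -
  obtain C where "is_cycle C" "subgraph C G" "verts C = verts G"
    using assms unfolding has_hamiltonian_cycle_def by blast
  moreover from this have "subgraph (translate t C) (translate t G)" "verts (translate t C) = verts (translate t G)"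
    by (auto simp: subgraph_def translate_def)
  ultimately show ?thesis
    unfolding has_hamiltonian_cycle_def using is_cycle_translate by blast
qed

lemma leaper_move_iff_adj: "leaper_move p q a b \<longleftrightarrow> adj (int p) (int q) a b"
proof -
  have "\<bar>x\<bar> = int n \<longleftrightarrow> (\<exists>s\<in>{1, -1}. x = s * int n)" for x n by (auto simp: abs_if)
  then show ?thesis
    unfolding leaper_move_def adj_def by (cases a; cases b) (auto simp: algebra_simps)
qed

lemma leaper_graph_eq: "leaper_graph p q B = graph_of (adj (int p) (int q)) B"
  by (simp add: leaper_graph_def graph_of_def leaper_move_iff_adj)

lemma finite_bd: "finite (bd h)"
  by (simp add: bd_def)

lemma decomposed_consists_of:
  fixes p q :: nat and P Q :: "nat \<Rightarrow> nat"
  assumes dec: "decomposed k h d C"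
    and nonneg: "\<And>i. i \<le> k \<Longrightarrow> 0 \<le> d i"
    and pq: "int p = h 0 - d 0" "int q = h 0 + d 0 + 1" "0 < p"
    and PQ: "\<And>i. i \<in> {1..k} \<Longrightarrow> int (P i) = h i - d i \<and> int (Q i) = h i + d i + 1"
  shows "\<exists>I T. int (card I) = (int q - int p)\<^sup>2 \<and>
    consists_of (leaper_graph p q (chessboard (p + q))) I (\<Union>i\<in>{1..k}. T i) \<and>
    (\<forall>i\<in>{1..k}. \<forall>j\<in>{1..k}. i \<noteq> j \<longrightarrow> T i \<inter> T j = {}) \<and>
    (\<forall>i\<in>{1..k}.
       int (card (T i)) = (int (Q i) - int (P i))\<^sup>2 \<and>
       (\<forall>C\<in>T i. \<forall>D\<in>T i. \<exists>t. D = translate t C) \<and>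
       (\<forall>C\<in>T i. toured_by C (P i) (Q i)))"
proof -
  \<comment> \<open>As \<open>p + q = 2 * h 0 + 1\<close>, this shift takes the centred board to the
    chessboard.\<close>
  define c where "c = (h 0, h 0)"
  define L where "L = ladj (h 0) (d 0)"
  have L: "adj (int p) (int q) = L" unfolding L_def pq ..
  have hd: "0 \<le> d 0" "d 0 < h 0" using nonneg[of 0] pq by auto
  have comp: "closed_in (h 0) (d 0) ((+) t ` C i)" "connected_on L ((+) t ` C i)"
    if "i \<le> k" "t \<in> bd (d i)" for i t
    unfolding L_def by (rule decomposed_closed[OF dec that], rule decomposed_connected[OF dec that])
  note cover = decomposed_cover[OF dec]
  have disj: "i = j \<and> t = t'"
    if "i \<le> k" "j \<le> k" "t \<in> bd (d i)" "t' \<in> bd (d j)" "a \<in> (+) t ` C i" "a \<in> (+) t' ` C j" for i j t t' a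
    using decomposed_disjoint[OF dec, of i j t t'] that by blast
  have quart: "\<exists>K N. quarter (h 0) (d 0) (int (P i)) (int (Q i)) (C i) K N" if "i \<in> {1..k}" for i
    using decomposed_quarter[OF dec that] PQ[OF that] by metis
  have C0: "(+) t ` C 0 = {t}" for t
    using decomposed_0[OF dec] by (simp flip: zero_prod_def)
  have ne: "C i \<noteq> {}" if i: "i \<in> {1..k}" for i
  proof -
    obtain K N where "quarter (h 0) (d 0) (int (P i)) (int (Q i)) (C i) K N" using quart[OF i] by blast
    then have "K \<noteq> []" "set K \<subseteq> C i" by (auto simp: quarter.K_ne quarter.set_K)
    then show ?thesis by (metis empty_set subset_empty set_empty)
  qed
  define S where "S i t = (+) (c + t) ` C i" for i t
  have S: "S i t = (+) c ` (+) t ` C i" for i t by (simp add: S_def image_image add.assoc)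
  define T where "T i = (\<lambda>t. graph_of L (S i t)) ` bd (d i)" for i
  define I where "I = (+) c ` bd (d 0)"
  have verts: "verts (graph_of L (S i t)) = S i t" for i t by (simp add: graph_of_def)
  have disj_S: "i = j \<and> t = t'"
    if "i \<le> k" "j \<le> k" "t \<in> bd (d i)" "t' \<in> bd (d j)" "a \<in> S i t" "a \<in> S j t'" for i j t t' a
  proof -
    obtain b where "a = c + b" "b \<in> (+) t ` C i" using \<open>a \<in> S i t\<close> unfolding S by blast
    moreover then have "b \<in> (+) t' ` C j" using \<open>a \<in> S j t'\<close> unfolding S by auto
    ultimately show ?thesis using disj that by blast
  qed
  have S0: "S 0 t = {c + t}" for t unfolding S C0 by simp
  have board: "chessboard (p + q) = (+) c ` bd (h 0)"
  proof -
    have n: "int (p + q) = 2 * h 0 + 1" using pq by simp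
    have "v \<in> (+) c ` bd (h 0) \<longleftrightarrow> v - c \<in> bd (h 0)" for v by (force simp: image_iff)
    then show ?thesis unfolding chessboard_def n by (auto simp: c_def bd_def)
  qed
  have graph: "leaper_graph p q (chessboard (p + q)) = graph_of L ((+) c ` bd (h 0))"
    unfolding leaper_graph_eq L board ..
  have irr: "\<not> L a a" for a using hd by (auto simp: L_def adj_def)
  have cycle: "is_cycle (graph_of L (S i t))" if i: "i \<in> {1..k}" "t \<in> bd (d i)" for i t
  proof -
    let ?S = "(+) t ` C i"
    have cl: "closed_in (h 0) (d 0) ?S" using comp i by simp
    \<comment> \<open>A square \<open>a\<close> of the central square is by itself the translate of
      \<open>C 0\<close> by \<open>a\<close>, hence disjoint from all translates of positive
      type.\<close>
    have "a \<notin> bd (d 0)" if "a \<in> ?S" for a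
      using disj[of i 0 t a a] C0[of a] that i by auto
    then have "two_regular_on L ?S"
      unfolding L_def by (intro closed_two_regular[OF hd cl]) auto
    moreover have "finite ?S"
      using cl finite_bd finite_subset unfolding closed_in_def by blast
    ultimately have "is_cycle (graph_of L ?S)"
      using connected_two_regular_is_cycle[of ?S L] comp(2)[of i t] i ne[OF i(1)] irr adj_commute
      unfolding L_def by simp
    then have "is_cycle (translate c (graph_of L ?S))" by (rule is_cycle_translate)
    then show ?thesis unfolding S L_def translate_graph_of .
  qed
  have consists: "consists_of (graph_of L ((+) c ` bd (h 0))) I (\<Union>i\<in>{1..k}. T i)"
    unfolding consists_of_def
  proof (intro conjI ballI impI)
    show "is_cycle D" if "D \<in> (\<Union>i\<in>{1..k}. T i)" for D
      using that cycle by (auto simp: T_def)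
    show "verts D \<inter> verts D' = {}"
      if DD: "D \<in> (\<Union>i\<in>{1..k}. T i)" "D' \<in> (\<Union>i\<in>{1..k}. T i)" "D \<noteq> D'" for D D'
    proof -
      obtain i t j t' where D: "i \<in> {1..k}" "t \<in> bd (d i)" "D = graph_of L (S i t)"
          "j \<in> {1..k}" "t' \<in> bd (d j)" "D' = graph_of L (S j t')"
        using DD(1,2) unfolding T_def by blast
      then have "S i t \<inter> S j t' = {}" using disj_S[of i j t t'] DD(3) by fastforce
      then show ?thesis unfolding D verts .
    qed
    show "I \<inter> verts D = {}" if "D \<in> (\<Union>i\<in>{1..k}. T i)" for D
    proof -
      obtain i t where D: "i \<in> {1..k}" "t \<in> bd (d i)" "D = graph_of L (S i t)"
        using \<open>D \<in> (\<Union>i\<in>{1..k}. T i)\<close> unfolding T_def by blast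
      have "c + a \<notin> S i t" if "a \<in> bd (d 0)" for a
        using disj_S[of 0 i a t "c + a"] S0[of a] that D by auto
      then show ?thesis unfolding D verts I_def by blast
    qed
    have all: "\<exists>i\<le>k. \<exists>t\<in>bd (d i). c + a \<in> S i t" if "a \<in> bd (h 0)" for a
      using cover[OF that] unfolding S by blast
    have sub: "S i t \<subseteq> (+) c ` bd (h 0)" if "i \<le> k" "t \<in> bd (d i)" for i t
      using comp(1)[OF that] unfolding S closed_in_def by blast
    show "verts (graph_of L ((+) c ` bd (h 0))) = I \<union> (\<Union>D\<in>(\<Union>i\<in>{1..k}. T i). verts D)"
    proof
      show "verts (graph_of L ((+) c ` bd (h 0))) \<subseteq> I \<union> (\<Union>D\<in>(\<Union>i\<in>{1..k}. T i). verts D)"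
      proof
        fix v assume "v \<in> verts (graph_of L ((+) c ` bd (h 0)))"
        then obtain a where a: "v = c + a" "a \<in> bd (h 0)" by (auto simp: graph_of_def)
        then obtain i t where i: "i \<le> k" "t \<in> bd (d i)" "v \<in> S i t" using all by blast
        show "v \<in> I \<union> (\<Union>D\<in>(\<Union>i\<in>{1..k}. T i). verts D)"
        proof (cases "i = 0")
          case True
          then show ?thesis using i S0 by (auto simp: I_def)
        next
          case False
          then have "i \<in> {1..k}" using i by auto
          then show ?thesis using i unfolding T_def by (auto simp: verts)
        qed
      qed
      have "bd (d 0) \<subseteq> bd (h 0)" using hd by (auto simp: bd_def)
      then show "I \<union> (\<Union>D\<in>(\<Union>i\<in>{1..k}. T i). verts D) \<subseteq> verts (graph_of L ((+) c ` bd (h 0)))"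
        using sub by (fastforce simp: I_def T_def graph_of_def)
    qed
    show "edges (graph_of L ((+) c ` bd (h 0))) = (\<Union>D\<in>(\<Union>i\<in>{1..k}. T i). edges D)"
    proof
      show "edges (graph_of L ((+) c ` bd (h 0))) \<subseteq> (\<Union>D\<in>(\<Union>i\<in>{1..k}. T i). edges D)"
      proof
        fix x assume "x \<in> edges (graph_of L ((+) c ` bd (h 0)))"
        then obtain a b where x: "x = {c + a, c + b}" "a \<in> bd (h 0)" "b \<in> bd (h 0)" "L (c + a) (c + b)"
          by (auto simp: graph_of_def)
        then have "L a b" by (simp add: L_def)
        obtain i t where i: "i \<le> k" "t \<in> bd (d i)" "a \<in> (+) t ` C i" using cover x by blast
        then have b: "b \<in> (+) t ` C i"
          using comp(1)[OF i(1,2)] \<open>L a b\<close> x unfolding closed_in_def L_def by blast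
        have "i \<noteq> 0"
        proof
          assume "i = 0"
          then have "a = t" "b = t" using i b C0 by auto
          then show False using irr \<open>L a b\<close> by simp
        qed
        then have "i \<in> {1..k}" "graph_of L (S i t) \<in> T i" using i unfolding T_def by auto
        moreover have "c + a \<in> S i t" "c + b \<in> S i t" using i b unfolding S by blast+
        then have "x \<in> edges (graph_of L (S i t))"
          using x unfolding graph_of_def snd_conv by blast
        ultimately show "x \<in> (\<Union>D\<in>(\<Union>i\<in>{1..k}. T i). edges D)" by blast
      qed
      show "(\<Union>D\<in>(\<Union>i\<in>{1..k}. T i). edges D) \<subseteq> edges (graph_of L ((+) c ` bd (h 0)))"
      proof
        fix x assume "x \<in> (\<Union>D\<in>(\<Union>i\<in>{1..k}. T i). edges D)"
        then obtain i t where i: "i \<in> {1..k}" "t \<in> bd (d i)" "x \<in> edges (graph_of L (S i t))"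
          unfolding T_def by blast
        then obtain a b where "x = {a, b}" "a \<in> S i t" "b \<in> S i t" "L a b"
          unfolding graph_of_def snd_conv by blast
        moreover have "S i t \<subseteq> (+) c ` bd (h 0)" by (rule sub) (use i in auto)
        ultimately show "x \<in> edges (graph_of L ((+) c ` bd (h 0)))"
          unfolding graph_of_def snd_conv by (intro CollectI exI[of _ a] exI[of _ b]) (simp only: subsetD simp_thms)
      qed
    qed
  qed
  have card_I: "int (card I) = (int q - int p)\<^sup>2"
  proof -
    have "card I = card (bd (d 0))" unfolding I_def by (simp add: card_image)
    moreover have "int q - int p = 2 * d 0 + 1" using pq by simp
    ultimately show ?thesis using card_bd[OF hd(1)] by simp
  qed
  have T_disj: "T i \<inter> T j = {}" if "i \<in> {1..k}" "j \<in> {1..k}" "i \<noteq> j" for i j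
  proof -
    have "graph_of L (S i t) \<noteq> graph_of L (S j t')" if "t \<in> bd (d i)" "t' \<in> bd (d j)" for t t'
    proof
      assume "graph_of L (S i t) = graph_of L (S j t')"
      then have "S i t = S j t'" using verts by metis
      moreover obtain a where "a \<in> S i t" using ne[OF \<open>i \<in> {1..k}\<close>] unfolding S_def by blast
      ultimately show False using disj_S[of i j t t' a] that \<open>i \<in> {1..k}\<close> \<open>j \<in> {1..k}\<close> \<open>i \<noteq> j\<close> by auto
    qed
    then show ?thesis unfolding T_def by blast
  qed
  have card_T: "int (card (T i)) = (int (Q i) - int (P i))\<^sup>2" if i: "i \<in> {1..k}" for i
  proof -
    have "inj_on (\<lambda>t. graph_of L (S i t)) (bd (d i))"
    proof (rule inj_onI)
      fix t t' assume tt: "t \<in> bd (d i)" "t' \<in> bd (d i)" "graph_of L (S i t) = graph_of L (S i t')"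
      then have "S i t = S i t'" using verts by metis
      moreover obtain a where "a \<in> S i t" using ne[OF i] unfolding S_def by blast
      ultimately show "t = t'" using disj_S[of i i t t' a] tt i by auto
    qed
    then have "card (T i) = card (bd (d i))" unfolding T_def by (rule card_image)
    moreover have "int (Q i) - int (P i) = 2 * d i + 1" using PQ[OF i] by simp
    ultimately show ?thesis using card_bd[OF nonneg[of i]] i by simp
  qed
  have T_translate: "\<exists>t. D' = translate t D" if D: "D \<in> T i" "D' \<in> T i" for i D D'
  proof -
    obtain t t' where "D = graph_of L (S i t)" "D' = graph_of L (S i t')" using D unfolding T_def by blast
    moreover have "S i t' = (+) (t' - t) ` S i t" unfolding S_def image_image
      by (intro image_cong refl) (simp add: algebra_simps)
    ultimately have "D' = translate (t' - t) D" unfolding L_def by (simp only: translate_graph_of)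
    then show ?thesis ..
  qed
  have T_toured: "toured_by D (P i) (Q i)" if D: "i \<in> {1..k}" "D \<in> T i" for i D
  proof -
    obtain t where t: "D = graph_of L (S i t)" using D(2) unfolding T_def by blast
    obtain K N where "quarter (h 0) (d 0) (int (P i)) (int (Q i)) (C i) K N" using quart[OF D(1)] by blast
    then have "has_hamiltonian_cycle (translate (c + t) (graph_of (adj (int (P i)) (int (Q i))) (C i)))"
      by (intro has_hamiltonian_cycle_translate quarter.hamiltonian)
    then show ?thesis
      unfolding toured_by_def t verts leaper_graph_eq unfolding S_def translate_graph_of .
  qed
  show ?thesis
    unfolding graph using card_I consists T_disj card_T T_translate T_toured by blast
qed

section \<open>Even continued fractions\<close>

text \<open>Even positive terms are at least 2, and a tail exceeding 1 changes the leading term by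
  less than 1.\<close>

lemma cf_value_gt_1:
  assumes "length cs = length ss + 1" "set ss \<subseteq> {1, -1}" "\<forall>c\<in>set cs. even c \<and> 0 < c"
  shows "1 < cf_value cs ss"
  using assms
proof (induction cs ss rule: cf_value.induct)
  case (1 c)
  then have "2 \<le> c" by auto
  then show ?case by simp
next
  case (2 c cs s ss)
  then have v: "1 < cf_value cs ss" by auto
  have "even c" "0 < c" using 2 by auto
  then have "2 \<le> c" by auto
  then have "(2 :: rat) \<le> of_int c" by (metis of_int_le_iff of_int_numeral)
  moreover have "- 1 < of_int s / cf_value cs ss" using v 2 by (auto simp: field_simps)
  ultimately show ?case by simp
qed auto

text \<open>The right-hand side is \<open>(c * Q' + s * P') / Q'\<close>, already in lowest terms
  because \<open>Q'\<close> is coprime to \<open>P'\<close>; so numerators and denominators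
  agree.\<close>

lemma fraction_step:
  fixes P Q P' Q' :: nat and c s :: int
  assumes cop: "coprime P Q" "coprime P' Q'" and pos: "0 < P" "0 < P'" "0 < Q'" and s: "s = 1 \<or> s = -1"
    and eq: "of_nat Q / of_nat P = (of_int c + of_int s / (of_nat Q' / of_nat P') :: rat)"
  shows "P = Q'" "int Q = c * int Q' + s * int P'"
proof -
  have "of_nat Q * of_nat Q' = (of_int c * of_nat Q' + of_int s * of_nat P') * (of_nat P :: rat)"
    using eq pos by (simp add: field_simps)
  then have "(of_int (int Q * int Q') :: rat) = of_int ((c * int Q' + s * int P') * int P)"
    by simp
  then have int_eq: "int Q * int Q' = (c * int Q' + s * int P') * int P"
    by (simp only: of_int_eq_iff)
  have "int P dvd int Q * int Q'" by (simp add: int_eq)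
  moreover have "coprime (int P) (int Q)" using cop(1) by simp
  ultimately have "int P dvd int Q'" by (simp add: coprime_dvd_mult_right_iff)
  moreover have "int Q' dvd int P"
  proof -
    have "coprime (int Q') (s * int P')" using cop(2) s by (auto simp: coprime_commute)
    then have "coprime (int Q') (c * int Q' + s * int P')"
      by (metis add.commute coprime_iff_gcd_eq_1 gcd_add_mult mult.commute)
    moreover have "int Q' dvd (c * int Q' + s * int P') * int P" by (simp flip: int_eq)
    ultimately show ?thesis by (simp add: coprime_dvd_mult_right_iff)
  qed
  ultimately show "P = Q'" using zdvd_antisym_nonneg by fastforce
  then show "int Q = c * int Q' + s * int P'" using int_eq pos by simp
qed

text \<open>The half-widths are integral because \<open>P i + Q i\<close> is odd: this holds at
  \<open>k\<close>, and since \<open>c\<close> is even it passes from \<open>Suc i\<close> to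
  \<open>i\<close>.\<close>

lemma tower_of_recurrence:
  fixes P Q :: "nat \<Rightarrow> nat"
  assumes last: "P k = 0" "Q k = 1"
    and step: "\<And>i. i < k \<Longrightarrow> \<exists>c s :: int. P i = Q (Suc i) \<and> int (Q i) = c * int (Q (Suc i)) + s * int (P (Suc i)) \<and>
      even c \<and> 0 < c \<and> (s = 1 \<or> s = -1)"
    and less: "\<And>i. i \<le> k \<Longrightarrow> P i < Q i"
  defines "h \<equiv> \<lambda>i. (int (P i) + int (Q i) - 1) div 2" and "d \<equiv> \<lambda>i. (int (Q i) - int (P i) - 1) div 2"
  shows "tower k h d" "\<And>i. i \<le> k \<Longrightarrow> int (P i) = h i - d i \<and> int (Q i) = h i + d i + 1"
proof -
  have odd: "odd (int (P i) + int (Q i))" if "i \<le> k" for i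
    using that
  proof (induction rule: inc_induct)
    case base
    then show ?case using last by simp
  next
    case (step i)
    obtain c s :: int where "P i = Q (Suc i)" "int (Q i) = c * int (Q (Suc i)) + s * int (P (Suc i))"
        "even c" "s = 1 \<or> s = -1"
      using assms(3)[OF \<open>i < k\<close>] by blast
    then show ?case using step.IH by auto
  qed
  show hd: "int (P i) = h i - d i \<and> int (Q i) = h i + d i + 1" if "i \<le> k" for i
    using odd[OF that] unfolding h_def d_def by presburger
  have "\<exists>g g2 m. lift g g2 m \<and> h i = lift.h g g2 m \<and> d i = lift.d g g2 m \<and>
      h (Suc i) = lift.hh g g2 \<and> d (Suc i) = lift.dd g g2" if "i < k" for i
  proof -
    obtain c s :: int where c: "P i = Q (Suc i)" "int (Q i) = c * int (Q (Suc i)) + s * int (P (Suc i))"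
        "even c" "0 < c" "s = 1 \<or> s = -1"
      using step[OF \<open>i < k\<close>] by blast
    obtain m where cm: "c = 2 * m" using \<open>even c\<close> by blast
    \<comment> \<open>\<open>e = g - g2\<close> has to be \<open>s * P (Suc i)\<close>, so the sign
      decides which of the two is the larger half-width.\<close>
    define g g2 where "g = (if s = 1 then h (Suc i) else d (Suc i))"
      and "g2 = (if s = 1 then d (Suc i) else h (Suc i))"
    have Suc: "int (P (Suc i)) = h (Suc i) - d (Suc i)" "int (Q (Suc i)) = h (Suc i) + d (Suc i) + 1"
      using hd[of "Suc i"] that by auto
    have "0 \<le> d (Suc i)" "d (Suc i) \<le> h (Suc i)"
      using less[of "Suc i"] that unfolding h_def d_def by (simp_all add: zdiv_mono1)
    then interpret lift g g2 m
      using c(4) cm by unfold_locales (auto simp: g_def g2_def)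
    have pq: "p = int (Q (Suc i))" "e = s * int (P (Suc i))"
      unfolding p_def e_def using c(5) Suc by (auto simp: g_def g2_def)
    have "int (P i) = p" "int (Q i) = 2 * w + e"
      using c cm pq by (auto simp: w_def)
    moreover have "lift.h g g2 m - lift.d g g2 m = p" "lift.h g g2 m + lift.d g g2 m + 1 = 2 * w + e"
      by (auto simp: h_def d_def p_def e_def)
    moreover note hd[of i]
    ultimately have "h i = lift.h g g2 m" "d i = lift.d g g2 m" using that by linarith+
    moreover have "h (Suc i) = hh" "d (Suc i) = dd"
      unfolding hh_def dd_def using \<open>d (Suc i) \<le> h (Suc i)\<close> by (auto simp: g_def g2_def)
    ultimately show ?thesis using lift_axioms by blast
  qed
  moreover have "h k = 0" "d k = 0" using last by (auto simp: h_def d_def)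
  ultimately show "tower k h d" unfolding tower_def by blast
qed

text \<open>Entry \<open>0\<close> is overwritten because the given fractions start at index
  \<open>1\<close>; with \<open>q / p\<close> in front, one recurrence covers all terms.\<close>

lemma even_cf_recurrence:
  fixes p q k :: nat and P Q :: "nat \<Rightarrow> nat"
  assumes "0 < p" "p < q" "coprime p q" "even_cf cs ss" "length cs = k"
    and cf0: "cf_value cs ss = of_nat q / of_nat p"
    and cf: "\<And>i. 1 \<le> i \<Longrightarrow> i < k \<Longrightarrow>
           P i > 0 \<and> coprime (P i) (Q i) \<and>
           cf_value (drop i cs) (drop i ss) = of_nat (Q i) / of_nat (P i)"
    and last: "P k = 0" "Q k = 1"
  defines "P' \<equiv> P(0 := p)" and "Q' \<equiv> Q(0 := q)"
  shows "i < k \<Longrightarrow> \<exists>c s :: int. P' i = Q' (Suc i) \<and> int (Q' i) = c * int (Q' (Suc i)) + s * int (P' (Suc i)) \<and>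
      even c \<and> 0 < c \<and> (s = 1 \<or> s = -1)"
    and "i \<le> k \<Longrightarrow> P' i < Q' i"
proof -
  have len: "length cs = length ss + 1" "set ss \<subseteq> {1, -1}" and ev: "\<forall>c\<in>set cs. even c"
    and hd: "0 \<le> hd cs" and tl: "\<forall>c\<in>set (tl cs). 0 < c"
    using assms(4) unfolding even_cf_def by auto
  have "0 < k" using len assms(5) by simp
  have frac: "0 < P' i" "coprime (P' i) (Q' i)" "cf_value (drop i cs) (drop i ss) = of_nat (Q' i) / of_nat (P' i)"
    if "i < k" for i
    using that cf[of i] cf0 assms(1,3) by (auto simp: P'_def Q'_def)
  have gt1: "1 < cf_value (drop i cs) (drop i ss)" if "i < k" for i
  proof (cases i)
    case 0
    then show ?thesis using cf0 assms(1,2) by simp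
  next
    case (Suc j)
    have "set (drop i cs) \<subseteq> set (tl cs)" unfolding Suc drop_Suc by (rule set_drop_subset)
    then have "\<forall>c\<in>set (drop i cs). even c \<and> 0 < c"
      using ev tl set_drop_subset[of i cs] by blast
    moreover have "set (drop i ss) \<subseteq> {1, -1}" using len set_drop_subset[of i ss] by blast
    moreover have "length (drop i cs) = length (drop i ss) + 1" using len assms(5) that by auto
    ultimately show ?thesis using cf_value_gt_1 by blast
  qed
  show less: "P' i < Q' i" if "i \<le> k" for i
  proof (cases "i = k")
    case True
    then show ?thesis using last \<open>0 < k\<close> by (simp add: P'_def Q'_def)
  next
    case False
    then have "1 < (of_nat (Q' i) / of_nat (P' i) :: rat)" "0 < P' i"
      using gt1[of i] frac[of i] that by auto
    then show ?thesis by (simp add: field_simps)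
  qed
  show "\<exists>c s :: int. P' i = Q' (Suc i) \<and> int (Q' i) = c * int (Q' (Suc i)) + s * int (P' (Suc i)) \<and>
      even c \<and> 0 < c \<and> (s = 1 \<or> s = -1)" if "i < k" for i
  proof -
    have drop: "drop i cs = cs ! i # drop (Suc i) cs" using that assms(5) by (simp add: Cons_nth_drop_Suc)
    have "even (cs ! i)" using ev that assms(5) by simp
    have pos: "0 \<le> cs ! i" "i \<noteq> 0 \<Longrightarrow> 0 < cs ! i"
    proof -
      show "0 < cs ! i" if "i \<noteq> 0"
        using tl \<open>i < k\<close> that assms(5) by (cases i) (auto simp: nth_tl[symmetric] simp del: nth_tl)
      then show "0 \<le> cs ! i" using hd \<open>i < k\<close> assms(5) by (cases "i = 0") (auto simp: hd_conv_nth)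
    qed
    show ?thesis
    proof (cases "Suc i = k")
      case True
      then have "drop (Suc i) cs = []" "drop i ss = []" using len assms(5) by auto
      then have v: "(of_nat (Q' i) / of_nat (P' i) :: rat) = of_int (cs ! i)"
        using frac(3)[OF that] drop by simp
      then have "(of_int (int (Q' i)) :: rat) = of_int (cs ! i * int (P' i))"
        using frac(1)[OF that] by (simp add: field_simps)
      then have Q: "int (Q' i) = cs ! i * int (P' i)" by (simp only: of_int_eq_iff)
      then have "int (P' i) dvd int (Q' i)" by simp
      then have "P' i = 1" using frac(2)[OF that] by (simp add: coprime_absorb_left)
      moreover have "Q' (Suc i) = 1" "P' (Suc i) = 0" using last True by (auto simp: P'_def Q'_def)
      moreover have "0 < cs ! i"
        using Q less[of i] that \<open>P' i = 1\<close> by simp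
      \<comment> \<open>The last term carries no sign; as \<open>P' k = 0\<close>, the value 1
        chosen for \<open>s\<close> has no effect.\<close>
      ultimately show ?thesis using Q \<open>even (cs ! i)\<close> by (intro exI[of _ "cs ! i"] exI[of _ 1]) simp
    next
      case False
      then have "Suc i < k" using that by simp
      then have "drop i ss = ss ! i # drop (Suc i) ss" "ss ! i \<in> set ss"
        using len assms(5) by (simp_all add: Cons_nth_drop_Suc)
      then have eq: "of_nat (Q' i) / of_nat (P' i) =
          (of_int (cs ! i) + of_int (ss ! i) / (of_nat (Q' (Suc i)) / of_nat (P' (Suc i))) :: rat)"
        using frac(3)[OF that] frac(3)[OF \<open>Suc i < k\<close>] drop by simp
      have s: "ss ! i = 1 \<or> ss ! i = -1" using \<open>ss ! i \<in> set ss\<close> len by auto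
      have less': "P' (Suc i) < Q' (Suc i)" using less \<open>Suc i < k\<close> by simp
      note fs = fraction_step[OF frac(2)[OF that] frac(2)[OF \<open>Suc i < k\<close>] frac(1)[OF that] frac(1)[OF \<open>Suc i < k\<close>] _ s eq]
      have PQ: "P' i = Q' (Suc i)" "int (Q' i) = cs ! i * int (Q' (Suc i)) + ss ! i * int (P' (Suc i))"
        using fs less' by auto
      \<comment> \<open>The first term might be zero by the definition of \<open>even_cf\<close>.
        But then \<open>Q' i \<le> P' (Suc i) < Q' (Suc i) = P' i\<close>, contrary to
        \<open>P' i < Q' i\<close>.\<close>
      have "cs ! i \<noteq> 0"
      proof
        assume "cs ! i = 0"
        then have "int (Q' i) \<le> int (P' (Suc i))" using PQ s by auto
        then show False using less[of i] less' PQ that by simp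
      qed
      then show ?thesis using PQ pos s \<open>even (cs ! i)\<close> by (metis order_le_less)
    qed
  qed
qed

theorem theorem3:
  fixes p q k :: nat and cs ss :: "int list" and P Q :: "nat \<Rightarrow> nat" and G :: "square ugraph"
  assumes "skew_leaper p q" and "basic_leaper p q" and "p < q"
    and "even_cf cs ss" and "length cs = k"
    and "cf_value cs ss = of_nat q / of_nat p"
    and "\<And>i. 1 \<le> i \<Longrightarrow> i < k \<Longrightarrow>
           P i > 0 \<and> coprime (P i) (Q i) \<and>
           cf_value (drop i cs) (drop i ss) = of_nat (Q i) / of_nat (P i)"
    and "P k = 0" and "Q k = 1"
    and "G = leaper_graph p q (chessboard (p + q))"
  shows "\<exists>I T. int (card I) = (int q - int p)\<^sup>2 \<and>
    consists_of G I (\<Union>i\<in>{1..k}. T i) \<and>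
    (\<forall>i\<in>{1..k}. \<forall>j\<in>{1..k}. i \<noteq> j \<longrightarrow> T i \<inter> T j = {}) \<and>
    (\<forall>i\<in>{1..k}.
       int (card (T i)) = (int (Q i) - int (P i))\<^sup>2 \<and>
       (\<forall>C\<in>T i. \<forall>D\<in>T i. \<exists>t. D = translate t C) \<and>
       (\<forall>C\<in>T i. toured_by C (P i) (Q i)))"
proof -
  have "0 < p" "coprime p q" using assms(1,2) by (auto simp: skew_leaper_def basic_leaper_def)
  define P' Q' where "P' = P(0 := p)" and "Q' = Q(0 := q)"
  note rec = even_cf_recurrence[OF \<open>0 < p\<close> assms(3) \<open>coprime p q\<close> assms(4-9), folded P'_def Q'_def]
  have "0 < k" using assms(4,5) by (auto simp: even_cf_def)
  then have last: "P' k = 0" "Q' k = 1" using assms(8,9) by (auto simp: P'_def Q'_def)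
  obtain h d where tower: "tower k h d"
    and PQ: "\<And>i. i \<le> k \<Longrightarrow> int (P' i) = h i - d i \<and> int (Q' i) = h i + d i + 1"
    using tower_of_recurrence[OF last rec] by blast
  obtain C where C: "decomposed k h d C" using tower_decomposed[OF tower] by blast
  have pq: "int p = h 0 - d 0" "int q = h 0 + d 0 + 1"
    using PQ[of 0] by (simp_all add: P'_def Q'_def)
  have PQ': "int (P i) = h i - d i \<and> int (Q i) = h i + d i + 1" if "i \<in> {1..k}" for i
    using PQ[of i] that by (simp add: P'_def Q'_def)
  show ?thesis
    unfolding assms(10)
    by (rule decomposed_consists_of[OF C tower_nonneg[OF tower] pq \<open>0 < p\<close> PQ'])
qed

end
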